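(* Fix a market $\mathcal M$ and a business $j$. With probability $1$ over the randomness in the history $H^{\mathcal M}$, the following happens. The posterior beliefs $(\mathcal P^F_{ij},\mathcal P^Q_{ij})$ converge in probability, as $i\to\infty$, to some $\mathcal P^{\lim}_j\in\Delta(\mathbb R)\times\Delta(\mathbb R)$. Moreover, either business $j$ is learned, in which case $(\mathcal P^F_{ij},\mathcal P^Q_{ij})$ converge to (the point masses at) $(\pi_j,Q_j)$, or else $\sigma_j(\hat\pi_{ij},\hat Q_{ij},\overline V)\le 0$ for some consumer $i$ (and every consumer afterwards), in which case we say that business $j$ is lost.
   Context: A market $\mathcal M$ consists of: $m$ businesses $j\in[m]$ with parameters $\pi_j\in(0,1)$ (fit probability) and $Q_j\in[0,1]$ (quality); fixed known prices $P_j\ge 0$; a value distribution $\mathcal D^V$ on $[0,\infty)$ that is regular (with CDF $\Psi$ and density $\psi$, $v-(1-\Psi(v))/\psi(v)$ is non-decreasing), has a density, and has bounded support with maximum $\overline V$; a common prior $\mathcal P=(\mathcal P^F_j,\mathcal P^Q_j)_{j\in[m]}$ under which all $\pi_j\sim\mathcal P^F_j$, $Q_j\sim\mathcal P^Q_j$ are independent; and a search cost $c\ge 0$. The parameters $(\pi_j,Q_j)_j$ are fixed and are a potential realization of the prior (lie in its support); probabilities below are for these fixed parameters. Consumers know everything except $(\pi_j,Q_j)_j$. Dynamics: in round $i=1,2,\dots$ consumer $i$ arrives with value $V_i\sim\mathcal D^V$ (i.i.d., privately known). For each $j$, fit $F_{ij}\sim\mathrm{Bernoulli}(\pi_j)$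 and quality realization $q_{ij}\sim\mathrm{Bernoulli}(Q_j)$, all independent. The consumer sequentially and adaptively inspects businesses, paying $c$ per inspection to observe $F_{ij}$; she may stop at any time and transact with at most one inspected business. Transacting with $j$ yields her expected transaction utility $V_iQ_jF_{ij}-P_j$ given $F_{ij}$; total utility $U_i$ is transaction utility minus total search cost. After round $i$, the history records the inspected businesses with their $F_{ij}$, and the business transacted with (if any) with its $q_{ij}$. $H^{\mathcal M}_n$ is the history of the first $n$ rounds ($H^{\mathcal M}$ the infinite one); consumer $i$ sees $H^{\mathcal M}_{i-1}$. Beliefs: $\mathcal P^F_{ij},\mathcal P^Q_{ij}$ are the Bayesian posteriors of $\pi_j,Q_j$ given $H^{\mathcal M}_{i-1}$, with means $\hat\pi_{ij},\hat Q_{ij}$. Consumers maximize expected utility given these beliefs: with index $\sigma_j(\hat\pi,\hat Q,V)=V\hat Q-P_j-c/\hat\pi$, consumer $i$ inspects the businesses with $\sigma_j(\hat\pi_{ij},\hat Q_{ij},V_i)>0$ in decreasing order of this index and transacts with the first inspected $j$ with $F_{ij}=1$ (if any), then leaves. Business $j$ is learned (for a realization of $H^{\mathcal M}$) if $(\mathcal P^F_{ij},\mathcal P^Q_{ij})\to(\pi_j,Q_j)$ in probability as $i\to\infty$, i.e. the posterior distributions concentrate at the true values. $\Delta(\mathbb R)$ is the set of probability distributions on $\mathbb R$. *)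

theory Defs
  imports "HOL-Probability.Probability"
begin

text \<open>
  Rounds and consumers are numbered from 0: consumer \<open>i\<close> acts in round \<open>i\<close> and sees the
  history of the first \<open>i\<close> rounds. Businesses are the natural numbers below \<open>num_businesses\<close>.
\<close>

definition msupport :: "'a::topological_space measure \<Rightarrow> 'a set" where
  "msupport M = {x. \<forall>U. open U \<and> x \<in> U \<longrightarrow> 0 < emeasure M U}"

text \<open>
  Public record of one round: the inspected businesses with their realized fits, and the business
  transacted with (if any) with its realized quality. The consumer's value is not recorded.
\<close>

type_synonym round_record = "(nat \<rightharpoonup> bool) \<times> (nat \<times> bool) option"
type_synonym history = "round_record list"

text \<open>Parameters \<open>(\<pi>, Q)\<close> of all businesses.\<close>

type_synonym params = "(nat \<Rightarrow> real) \<times> (nat \<Rightarrow> real)"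

text \<open>Randomness of one round: value, fits and quality realizations.\<close>

type_synonym shock = "real \<times> (nat \<Rightarrow> bool) \<times> (nat \<Rightarrow> bool)"

text \<open>
  The field \<open>tie_order\<close> only matters for businesses with equal index: among those, a consumer with
  value \<open>v\<close> seeing history \<open>h\<close> inspects in the order in which they occur in the list
  \<open>tie_order h v\<close>.
\<close>

record market =
  num_businesses :: nat
  fit_prob :: "nat \<Rightarrow> real"
  quality :: "nat \<Rightarrow> real"
  price :: "nat \<Rightarrow> real"
  value_density :: "real \<Rightarrow> real"
  fit_prior :: "nat \<Rightarrow> real measure"
  quality_prior :: "nat \<Rightarrow> real measure"
  search_cost :: real
  tie_order :: "history \<Rightarrow> real \<Rightarrow> nat list"

definition value_dist :: "market \<Rightarrow> real measure" where
  "value_dist M = density lborel (\<lambda>v. ennreal (value_density M v))"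

definition max_value :: "market \<Rightarrow> real" where
  "max_value M = Sup (msupport (value_dist M))"

text \<open>
  Extended-real arithmetic is used so that the virtual value is \<open>-\<infinity>\<close> where the density vanishes
  and \<open>\<Psi> v < 1\<close> (below the support or in a gap of it), and \<open>v\<close> where \<open>\<Psi> v = 1\<close>.
\<close>

definition regular_value_dist :: "market \<Rightarrow> bool" where
  "regular_value_dist M \<longleftrightarrow>
     mono_on {0..} (\<lambda>v. ereal v - ereal (1 - cdf (value_dist M) v) / ereal (value_density M v))"

definition true_params :: "market \<Rightarrow> params" where
  "true_params M = (fit_prob M, quality M)"

definition valid_market :: "market \<Rightarrow> bool" where
  "valid_market M \<longleftrightarrow>
     value_density M \<in> borel_measurable borel \<and>
     (\<forall>v. 0 \<le> value_density M v) \<and>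
     prob_space (value_dist M) \<and>
     (AE v in value_dist M. 0 \<le> v) \<and>
     bounded (msupport (value_dist M)) \<and>
     regular_value_dist M \<and>
     0 \<le> search_cost M \<and>
     (\<forall>j < num_businesses M.
        fit_prob M j \<in> {0<..<1} \<and> quality M j \<in> {0..1} \<and> 0 \<le> price M j \<and>
        real_distribution (fit_prior M j) \<and> (AE x in fit_prior M j. x \<in> {0<..<1}) \<and>
        real_distribution (quality_prior M j) \<and> (AE x in quality_prior M j. x \<in> {0..1}) \<and>
        fit_prob M j \<in> msupport (fit_prior M j) \<and>
        quality M j \<in> msupport (quality_prior M j)) \<and>
     (\<forall>h v. distinct (tie_order M h v) \<and> set (tie_order M h v) = {..<num_businesses M}) \<and>
     (\<forall>h. tie_order M h \<in> borel \<rightarrow>\<^sub>M count_space UNIV)"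

definition prior :: "market \<Rightarrow> params measure" where
  "prior M = (\<Pi>\<^sub>M j\<in>{..<num_businesses M}. fit_prior M j) \<Otimes>\<^sub>M
             (\<Pi>\<^sub>M j\<in>{..<num_businesses M}. quality_prior M j)"

definition shock_dist :: "market \<Rightarrow> params \<Rightarrow> shock measure" where
  "shock_dist M \<theta> = value_dist M \<Otimes>\<^sub>M
     (\<Pi>\<^sub>M j\<in>{..<num_businesses M}. measure_pmf (bernoulli_pmf (fst \<theta> j))) \<Otimes>\<^sub>M
     (\<Pi>\<^sub>M j\<in>{..<num_businesses M}. measure_pmf (bernoulli_pmf (snd \<theta> j)))"

definition sample_space :: "market \<Rightarrow> params \<Rightarrow> (nat \<Rightarrow> shock) measure" where
  "sample_space M \<theta> = (\<Pi>\<^sub>M i\<in>UNIV. shock_dist M \<theta>)"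

definition index :: "market \<Rightarrow> nat \<Rightarrow> real \<Rightarrow> real \<Rightarrow> real \<Rightarrow> real" where
  "index M j p q v = v * q - price M j - search_cost M / p"

definition fit_marginal :: "params measure \<Rightarrow> nat \<Rightarrow> real measure" where
  "fit_marginal B j = distr B borel (\<lambda>\<theta>. fst \<theta> j)"

definition quality_marginal :: "params measure \<Rightarrow> nat \<Rightarrow> real measure" where
  "quality_marginal B j = distr B borel (\<lambda>\<theta>. snd \<theta> j)"

definition mean :: "real measure \<Rightarrow> real" where
  "mean D = (\<integral>x. x \<partial>D)"

definition belief_index :: "market \<Rightarrow> params measure \<Rightarrow> nat \<Rightarrow> real \<Rightarrow> real" where
  "belief_index M B j v = index M j (mean (fit_marginal B j)) (mean (quality_marginal B j)) v"

text \<open>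
  The businesses of positive index in decreasing order of index; \<^const>\<open>sort_key\<close> is stable, so
  ties are resolved by \<open>tie_order\<close>.
\<close>

definition search_order :: "market \<Rightarrow> params measure \<Rightarrow> history \<Rightarrow> real \<Rightarrow> nat list" where
  "search_order M B h v =
     sort_key (\<lambda>j. - belief_index M B j v)
       (filter (\<lambda>j. 0 < belief_index M B j v) (tie_order M h v))"

definition inspected :: "nat list \<Rightarrow> (nat \<Rightarrow> bool) \<Rightarrow> nat set" where
  "inspected js f = set (takeWhile (\<lambda>j. \<not> f j) js) \<union> set_option (find f js)"

definition search_record :: "nat list \<Rightarrow> (nat \<Rightarrow> bool) \<Rightarrow> (nat \<Rightarrow> bool) \<Rightarrow> round_record" where
  "search_record js f q =
     ((\<lambda>j. if j \<in> inspected js f then Some (f j) else None),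
      map_option (\<lambda>j. (j, q j)) (find f js))"

definition round_outcome :: "market \<Rightarrow> params measure \<Rightarrow> history \<Rightarrow> shock \<Rightarrow> round_record" where
  "round_outcome M B h = (\<lambda>(v, f, q). search_record (search_order M B h v) f q)"

text \<open>
  \<open>posterior M H h\<close> is the conditional distribution of the parameters given that the random history
  \<open>H\<close> takes the value \<open>h\<close>. If this event has prior probability 0, it is the null measure.
\<close>

definition likelihood ::
    "market \<Rightarrow> ((nat \<Rightarrow> shock) \<Rightarrow> history) \<Rightarrow> history \<Rightarrow> params \<Rightarrow> real" where
  "likelihood M H h \<theta> =
     measure (sample_space M \<theta>) {\<omega> \<in> space (sample_space M \<theta>). H \<omega> = h}"

definition posterior ::
    "market \<Rightarrow> ((nat \<Rightarrow> shock) \<Rightarrow> history) \<Rightarrow> history \<Rightarrow> params measure" where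
  "posterior M H h =
     density (prior M)
       (\<lambda>\<theta>. ennreal (likelihood M H h \<theta> / (\<integral>\<theta>'. likelihood M H h \<theta>' \<partial>prior M)))"

primrec hist :: "market \<Rightarrow> nat \<Rightarrow> (nat \<Rightarrow> shock) \<Rightarrow> history" where
  "hist M 0 = (\<lambda>\<omega>. [])"
| "hist M (Suc n) =
     (\<lambda>\<omega>. hist M n \<omega> @
       [round_outcome M (posterior M (hist M n) (hist M n \<omega>)) (hist M n \<omega>) (\<omega> n)])"

definition belief :: "market \<Rightarrow> nat \<Rightarrow> (nat \<Rightarrow> shock) \<Rightarrow> params measure" where
  "belief M i \<omega> = posterior M (hist M i) (hist M i \<omega>)"

definition fit_belief :: "market \<Rightarrow> nat \<Rightarrow> (nat \<Rightarrow> shock) \<Rightarrow> nat \<Rightarrow> real measure" where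
  "fit_belief M j \<omega> i = fit_marginal (belief M i \<omega>) j"

definition quality_belief :: "market \<Rightarrow> nat \<Rightarrow> (nat \<Rightarrow> shock) \<Rightarrow> nat \<Rightarrow> real measure" where
  "quality_belief M j \<omega> i = quality_marginal (belief M i \<omega>) j"

definition concentrates_at :: "(nat \<Rightarrow> real measure) \<Rightarrow> real \<Rightarrow> bool" where
  "concentrates_at D a \<longleftrightarrow>
     (\<forall>\<epsilon>>0. (\<lambda>i. measure (D i) {x. \<epsilon> < \<bar>x - a\<bar>}) \<longlonglongrightarrow> 0)"

definition learned :: "market \<Rightarrow> nat \<Rightarrow> (nat \<Rightarrow> shock) \<Rightarrow> bool" where
  "learned M j \<omega> \<longleftrightarrow>
     concentrates_at (fit_belief M j \<omega>) (fit_prob M j) \<and>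
     concentrates_at (quality_belief M j \<omega>) (quality M j)"

definition lost :: "market \<Rightarrow> nat \<Rightarrow> (nat \<Rightarrow> shock) \<Rightarrow> bool" where
  "lost M j \<omega> \<longleftrightarrow>
     (\<exists>i. \<forall>i'\<ge>i. index M j (mean (fit_belief M j \<omega> i')) (mean (quality_belief M j \<omega> i'))
                   (max_value M) \<le> 0)"

end

theory Submission
  imports Defs
begin

text \<open>
  The likelihood of a history factors into a parameter-free constant and, for every business, a
  Bernoulli likelihood of its observed fits and one of its observed qualities. Hence the posterior
  marginals of a business depend only on its own two lists of observations. If the list of fits grows
  forever, its empirical frequency tends to the true fit probability: replacing the true parameter by
  a wrong one in the likelihood gives a likelihood-ratio martingale, which, stopped at the k-th
  observation, bounds the probability of a deviation by a term exponentially small in k. The quality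
  observations are as numerous as the successful fits, so the same holds for them, and both posteriors
  concentrate at the truth. Otherwise the posterior is eventually constant. If its index at the maximal
  value were positive, then every later round would inspect the business with probability bounded
  away from zero, which almost surely cannot fail forever.
\<close>

subsection \<open>Bernoulli likelihoods and consistency of their posteriors\<close>

text \<open>The true parameters are fixed points of the prior's support, not draws from it, so
  consistency for prior-almost every parameter (Doob) would not suffice. Instead, likelihoods far
  from the truth are compared with those on a small ball around it, which has positive prior mass.
  The obstacle is adaptivity: the rounds in which a business is observed depend on the past, so its
  observations are not i.i.d. along the rounds. Counting observations instead of rounds yields, for
  each k, an event about the first k observations whose bound is the same in all rounds, and
  Borel-Cantelli runs over k. In the bounded case, the beliefs about the other businesses may keep
  changing. A round in which no business fits forces the whole search list to be inspected, wherever
  the business stands in it, so the inspection probability is bounded below independently of those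
  beliefs. The final lists of observations are random but range over a countable set, so they may be
  fixed in advance.\<close>

definition bern_lik :: "real \<Rightarrow> bool list \<Rightarrow> real" where
  "bern_lik x l = prod_list (map (pmf (bernoulli_pmf x)) l)"

lemma bern_lik_Nil [simp]: "bern_lik x [] = 1"
  and bern_lik_Cons [simp]: "bern_lik x (b # l) = pmf (bernoulli_pmf x) b * bern_lik x l"
  and bern_lik_append: "bern_lik x (l @ l') = bern_lik x l * bern_lik x l'"
  by (simp_all add: bern_lik_def)

lemma bern_lik_nonneg: "0 \<le> bern_lik x l"
  by (induction l) auto

lemma bern_lik_le_1: "bern_lik x l \<le> 1"
  by (induction l) (auto intro: mult_le_one bern_lik_nonneg pmf_le_1)

text \<open>
  \<^const>\<open>bernoulli_pmf\<close> clamps its parameter to the unit interval, so that the likelihoods are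
  continuous on the whole line.
\<close>

lemma continuous_on_pmf_bernoulli: "continuous_on UNIV (\<lambda>x. pmf (bernoulli_pmf x) b)"
proof -
  have "(\<lambda>x. pmf (bernoulli_pmf x) b) = (\<lambda>x. if b then min 1 (max 0 x) else 1 - min 1 (max 0 x))"
    by (auto simp: bernoulli_pmf.rep_eq)
  then show ?thesis by (cases b) (simp_all only: if_True if_False, auto intro!: continuous_intros)
qed

lemma continuous_on_bern_lik: "continuous_on UNIV (\<lambda>x. bern_lik x l)"
  by (induction l) (auto intro!: continuous_intros continuous_on_pmf_bernoulli)

lemma borel_measurable_bern_lik [measurable]: "(\<lambda>x. bern_lik x l) \<in> borel_measurable borel"
  by (rule borel_measurable_continuous_onI[OF continuous_on_bern_lik])

lemma bern_lik_eq:
  assumes "x \<in> {0..1}"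
  shows "bern_lik x l = x ^ count_list l True * (1 - x) ^ count_list l False"
  using assms by (induction l) (auto split: bool.splits simp: algebra_simps)

lemma count_list_True_False: "count_list l True + count_list l False = length l"
  by (induction l) auto

definition bayes_density :: "real measure \<Rightarrow> bool list \<Rightarrow> real \<Rightarrow> real" where
  "bayes_density \<mu> l p = bern_lik p l / (\<integral>q. bern_lik q l \<partial>\<mu>)"

definition bayes :: "real measure \<Rightarrow> bool list \<Rightarrow> real measure" where
  "bayes \<mu> l = density \<mu> (\<lambda>p. ennreal (bayes_density \<mu> l p))"

lemma borel_measurable_bayes_density [measurable]: "bayes_density \<mu> l \<in> borel_measurable borel"
  unfolding bayes_density_def by measurable

lemma integrable_bern_lik:
  assumes "real_distribution \<mu>" shows "integrable \<mu> (\<lambda>p. bern_lik p l)"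
proof -
  interpret real_distribution \<mu> by fact
  show ?thesis
    by (rule integrable_const_bound[of _ 1]) (auto simp: bern_lik_nonneg bern_lik_le_1)
qed

text \<open>By continuity the likelihood is positive on a neighbourhood of \<open>x\<close>, which
  has positive mass since \<open>x\<close> lies in the support. This keeps Bayes' rule from being
  0/0 even if \<open>x\<close> is no atom of the prior.\<close>

lemma integral_bern_lik_pos:
  assumes "real_distribution \<mu>" "x \<in> msupport \<mu>" "0 < bern_lik x l"
  shows "0 < (\<integral>q. bern_lik q l \<partial>\<mu>)"
proof -
  interpret real_distribution \<mu> by fact
  define U where "U = {p. 0 < bern_lik p l}"
  have "open U" unfolding U_def
    by (intro open_Collect_less continuous_on_bern_lik continuous_intros)
  then have "0 < emeasure \<mu> U"
    using assms(2,3) by (auto simp: msupport_def U_def)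
  moreover have "emeasure \<mu> U = 0" if "AE p in \<mu>. bern_lik p l = 0"
    using emeasure_eq_0_AE[of "\<lambda>p. 0 < bern_lik p l" \<mu>] eventually_mono[OF that]
    by (simp add: U_def)
  ultimately have "\<not> (AE p in \<mu>. bern_lik p l = 0)" by auto
  then have "(\<integral>q. bern_lik q l \<partial>\<mu>) \<noteq> 0"
    by (subst integral_nonneg_eq_0_iff_AE[OF integrable_bern_lik[OF assms(1)]])
       (auto simp: bern_lik_nonneg)
  moreover have "0 \<le> (\<integral>q. bern_lik q l \<partial>\<mu>)"
    by (simp add: bern_lik_nonneg)
  ultimately show ?thesis by simp
qed

lemma measure_bayes:
  assumes "real_distribution \<mu>" "A \<in> sets borel" "0 < (\<integral>q. bern_lik q l \<partial>\<mu>)"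
  shows "measure (bayes \<mu> l) A = (\<integral>p. indicator A p * bern_lik p l \<partial>\<mu>) / (\<integral>q. bern_lik q l \<partial>\<mu>)"
proof -
  interpret real_distribution \<mu> by fact
  let ?Z = "\<integral>q. bern_lik q l \<partial>\<mu>"
  have "emeasure (bayes \<mu> l) A = (\<integral>\<^sup>+p. ennreal (bern_lik p l / ?Z * indicator A p) \<partial>\<mu>)"
    unfolding bayes_def bayes_density_def using assms
    by (subst emeasure_density) (auto intro!: nn_integral_cong simp: indicator_def)
  also have "\<dots> = ennreal (\<integral>p. bern_lik p l / ?Z * indicator A p \<partial>\<mu>)"
    using assms
    by (intro nn_integral_eq_integral integrable_real_mult_indicator integrable_divide integrable_bern_lik)
       (auto simp: bern_lik_nonneg)
  finally have "measure (bayes \<mu> l) A = (\<integral>p. bern_lik p l / ?Z * indicator A p \<partial>\<mu>)"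
    using assms by (simp add: measure_def bern_lik_nonneg)
  also have "\<dots> = (\<integral>p. indicator A p * bern_lik p l / ?Z \<partial>\<mu>)"
    by (simp add: field_simps)
  finally show ?thesis by simp
qed

lemma real_distribution_bayes:
  assumes "real_distribution \<mu>" "0 < (\<integral>q. bern_lik q l \<partial>\<mu>)"
  shows "real_distribution (bayes \<mu> l)"
proof -
  interpret real_distribution \<mu> by fact
  have "measure (bayes \<mu> l) UNIV = 1"
    using assms by (simp add: measure_bayes)
  then have "prob_space (bayes \<mu> l)"
    by (intro prob_spaceI) (auto simp: bayes_def measure_def space_density enn2real_eq_posreal_iff)
  then show ?thesis
    by (intro real_distribution.intro) (auto simp: real_distribution_axioms_def bayes_def)
qed

text \<open>Used to integrate out the other coordinates of a product posterior.\<close>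

lemma nn_integral_bayes_density:
  assumes "real_distribution \<mu>" "0 < (\<integral>q. bern_lik q l \<partial>\<mu>)"
  shows "(\<integral>\<^sup>+p. ennreal (bayes_density \<mu> l p) \<partial>\<mu>) = 1"
proof -
  interpret real_distribution \<mu> by fact
  interpret B: real_distribution "bayes \<mu> l" by (rule real_distribution_bayes[OF assms])
  show ?thesis
    using B.emeasure_space_1 unfolding bayes_def
    by (subst (asm) emeasure_density) (auto simp: space_density)
qed

text \<open>The left side is the Bhattacharyya coefficient of two Bernoulli laws, that is, 1 minus
  half the sum of squared differences of the roots. The 8 comes from this half and from
  \<open>(sqrt x + sqrt p)\<^sup>2 \<le> 4\<close>. Unlike relative entropy, it stays finite and
  uniform up to \<open>p = 0\<close> and \<open>p = 1\<close>.\<close>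

lemma bhattacharyya_le:
  fixes x p :: real
  assumes "x \<in> {0..1}" "p \<in> {0..1}"
  shows "sqrt (x * p) + sqrt ((1 - x) * (1 - p)) \<le> 1 - (x - p)\<^sup>2 / 8"
proof -
  let ?a = "sqrt x" and ?b = "sqrt p" and ?c = "sqrt (1 - x)" and ?d = "sqrt (1 - p)"
  have sq: "?a\<^sup>2 = x" "?b\<^sup>2 = p" "?c\<^sup>2 = 1 - x" "?d\<^sup>2 = 1 - p"
    using assms by auto
  have "?a \<le> 1" "?b \<le> 1" using assms by auto
  then have "?a + ?b \<le> 2" by linarith
  then have "(?a + ?b)\<^sup>2 \<le> 2\<^sup>2"
    using assms by (intro power_mono) auto
  then have "(?a - ?b)\<^sup>2 * (?a + ?b)\<^sup>2 \<le> (?a - ?b)\<^sup>2 * 4"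
    by (intro mult_left_mono) auto
  moreover have "(?a - ?b)\<^sup>2 * (?a + ?b)\<^sup>2 = (x - p)\<^sup>2"
    using sq by (simp add: algebra_simps power2_eq_square flip: power_mult_distrib)
  ultimately have "(x - p)\<^sup>2 / 4 \<le> (?a - ?b)\<^sup>2" by simp
  also have "\<dots> \<le> (?a - ?b)\<^sup>2 + (?c - ?d)\<^sup>2" by simp
  also have "\<dots> = 2 - 2 * (?a * ?b + ?c * ?d)"
    using sq by (simp add: power2_diff algebra_simps)
  finally show ?thesis by (simp add: real_sqrt_mult)
qed

text \<open>The AM-GM inequality is applied to the square roots of the two likelihood ratios.\<close>

lemma bern_lik_ratio_le:
  fixes y p s :: real
  assumes "y \<in> {0<..<1}" "p \<in> {0..1}" "l \<noteq> []"
    and s: "s = count_list l True / length l"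
    and \<rho>: "s * sqrt (p / y) + (1 - s) * sqrt ((1 - p) / (1 - y)) \<le> \<rho>"
  shows "bern_lik p l \<le> (\<rho>\<^sup>2) ^ length l * bern_lik y l"
proof -
  let ?N = "length l" and ?a = "count_list l True" and ?b = "count_list l False"
  let ?u = "sqrt (p / y)" and ?v = "sqrt ((1 - p) / (1 - y))"
  have N: "0 < ?N" using assms by simp
  have ab: "?a + ?b = ?N" by (rule count_list_True_False)
  have "real ?N - real ?a = real ?b" using ab by linarith
  then have s1: "1 - s = ?b / ?N" using N by (simp add: s diff_divide_distrib flip: \<open>real ?N - real ?a = real ?b\<close>)
  have uv: "0 \<le> ?u" "0 \<le> ?v" using assms by auto
  \<comment> \<open>Young's inequality in \<open>powr\<close> form needs positive bases. A zero root
    with positive exponent makes the left side 0; one with exponent 0 leaves a sample of a single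
    kind, where the claim is monotonicity of powers.\<close>
  have main: "?u ^ ?a * ?v ^ ?b \<le> \<rho> ^ ?N"
  proof (cases "(?a > 0 \<and> ?u = 0) \<or> (?b > 0 \<and> ?v = 0)")
    case True
    have "0 \<le> s * ?u + (1 - s) * ?v" using uv s s1 by simp
    then show ?thesis using True \<rho> by (auto simp: power_0_left)
  next
    case F: False
    have pw: "z powr (real k / real ?N) = root ?N (z ^ k)" if "0 < z" for z k
      using that N by (simp add: root_powr_inverse powr_powr flip: powr_realpow)
    show ?thesis
    proof (cases "?u = 0 \<or> ?v = 0")
      case True
      then consider "?u = 0" "?a = 0" | "?v = 0" "?b = 0" using F by auto
      then show ?thesis
      proof cases
        case 1 then have "?v \<le> \<rho>" using \<rho> s by simp
        then show ?thesis using 1 ab uv by (simp add: power_mono)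
      next
        case 2 then have "s = 1" using s1 by simp
        then have "?u \<le> \<rho>" using \<rho> by simp
        then show ?thesis using 2 ab uv by (simp add: power_mono)
      qed
    next
      case False
      have uv0: "0 < ?u" "0 < ?v" using uv False unfolding less_le by metis+
      have "0 \<le> s" "0 \<le> 1 - s" unfolding s1 by (auto simp: s)
      then have "?u powr s * ?v powr (1 - s) \<le> s * ?u + (1 - s) * ?v"
        by (intro Youngs_inequality_0 uv0) auto
      then have "root ?N (?u ^ ?a * ?v ^ ?b) \<le> \<rho>"
        using pw[OF uv0(1), of ?a] pw[OF uv0(2), of ?b] \<rho> by (simp add: s1 real_root_mult) (simp add: s)
      then have "root ?N (?u ^ ?a * ?v ^ ?b) ^ ?N \<le> \<rho> ^ ?N"
        by (intro power_mono real_root_ge_zero mult_nonneg_nonneg zero_le_power uv)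
      then show ?thesis using N uv by simp
    qed
  qed
  have "p ^ ?a * (1 - p) ^ ?b = (?u ^ ?a * ?v ^ ?b)\<^sup>2 * (y ^ ?a * (1 - y) ^ ?b)"
  proof -
    have "?u\<^sup>2 = p / y" "?v\<^sup>2 = (1 - p) / (1 - y)" using assms by auto
    then have "(?u ^ ?a * ?v ^ ?b)\<^sup>2 = (p / y) ^ ?a * ((1 - p) / (1 - y)) ^ ?b"
      by (metis power_mult_distrib power_commuting_commutes power_mult mult.commute)
    then show ?thesis using assms by (simp add: power_divide)
  qed
  also have "\<dots> \<le> (\<rho> ^ ?N)\<^sup>2 * (y ^ ?a * (1 - y) ^ ?b)"
    using main uv assms by (intro mult_right_mono power_mono) auto
  finally show ?thesis
    using assms by (simp add: bern_lik_eq flip: power_mult) (simp add: mult.commute)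
qed

text \<open>Every \<open>p\<close> farther than \<epsilon> from \<open>x\<close> has a likelihood
  exponentially smaller than every \<open>y\<close> in a ball around \<open>x\<close>, at a rate
  uniform in both. The comparison is with a ball because \<open>x\<close> itself may have prior mass
  0; the support hypothesis gives the ball positive mass.\<close>

lemma concentrates_at_bayes:
  assumes \<mu>: "real_distribution \<mu>" and AE\<mu>: "AE p in \<mu>. p \<in> {0..1}" and supp: "x \<in> msupport \<mu>"
    and x: "x \<in> {0..1}" and pos: "\<And>n. 0 < bern_lik x (l n)"
    and len: "filterlim (\<lambda>n. length (l n)) at_top sequentially"
    and freq: "(\<lambda>n. count_list (l n) True / length (l n)) \<longlonglongrightarrow> x"
  shows "concentrates_at (\<lambda>n. bayes \<mu> (l n)) x"
  unfolding concentrates_at_def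
proof (intro allI impI)
  fix \<epsilon> :: real assume \<epsilon>: "0 < \<epsilon>"
  interpret real_distribution \<mu> by fact
  have ev_len: "eventually (\<lambda>n. l n \<noteq> []) sequentially"
    using len[unfolded filterlim_at_top, rule_format, of 1] by eventually_elim auto
  obtain \<rho> \<delta> where \<rho>: "0 \<le> \<rho>" "\<rho> < 1" and \<delta>: "0 < \<delta>" and
    ev: "eventually (\<lambda>n. \<forall>p\<in>{0..1}. \<forall>y\<in>{0..1}. \<epsilon> < \<bar>p - x\<bar> \<longrightarrow> \<bar>y - x\<bar> < \<delta> \<longrightarrow>
        bern_lik p (l n) \<le> \<rho> ^ length (l n) * bern_lik y (l n)) sequentially"
  proof (cases "x \<in> {0<..<1}")
    case True
    \<comment> \<open>At frequency and reference point \<open>x\<close> the coefficient is at most 1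
      - \<epsilon>^2/8; half of this gap is kept and half is spent on the error \<open>G\<close>.
      The cap 1/2 keeps \<rho> nonnegative for large \<epsilon>.\<close>
    define \<rho> where "\<rho> = 1 - min (\<epsilon>\<^sup>2 / 16) (1/2)"
    have \<rho>: "0 \<le> \<rho>" "\<rho> < 1" using \<epsilon> by (auto simp: \<rho>_def)
    \<comment> \<open>For \<open>z = (s, y)\<close>, this bounds the error of replacing both the
      observed frequency \<open>s\<close> and the reference parameter \<open>y\<close> by
      \<open>x\<close>. It does not involve \<open>p\<close>, since \<open>sqrt p\<close> and
      \<open>sqrt (1 - p)\<close> are at most 1.\<close>
    define G where "G = (\<lambda>z. \<bar>fst z / sqrt (snd z) - sqrt x\<bar> + \<bar>(1 - fst z) / sqrt (1 - snd z) - sqrt (1 - x)\<bar> :: real)"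
    have "(G \<longlongrightarrow> \<bar>x / sqrt x - sqrt x\<bar> + \<bar>(1 - x) / sqrt (1 - x) - sqrt (1 - x)\<bar>) (nhds (x, x))"
      unfolding G_def using True
      by (auto intro!: tendsto_intros tendsto_fst[OF filterlim_ident, of "(x,x)", simplified]
           tendsto_snd[OF filterlim_ident, of "(x,x)", simplified])
    then have "(G \<longlongrightarrow> 0) (nhds (x, x))"
      using True by (simp add: real_div_sqrt)
    then have "eventually (\<lambda>z. G z < \<epsilon>\<^sup>2 / 16) (nhds (x, x))"
      using \<epsilon> by (intro order_tendstoD) auto
    moreover have "eventually (\<lambda>z. snd z \<in> {0<..<1}) (nhds (x, x))"
      using True
      by (intro topological_tendstoD[OF tendsto_snd[OF filterlim_ident, of "(x,x)", simplified]]) auto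
    ultimately have "eventually (\<lambda>z. G z < \<epsilon>\<^sup>2 / 16 \<and> snd z \<in> {0<..<1}) (nhds (x, x))"
      by (rule eventually_conj)
    then obtain P Q where P: "eventually P (nhds x)" and Q: "eventually Q (nhds x)"
      and PQ: "\<And>s y. P s \<Longrightarrow> Q y \<Longrightarrow> G (s, y) < \<epsilon>\<^sup>2 / 16 \<and> y \<in> {0<..<1}"
      unfolding nhds_prod eventually_prod_filter by (auto)
    obtain \<delta> where \<delta>: "0 < \<delta>" "\<And>y. \<bar>y - x\<bar> < \<delta> \<Longrightarrow> Q y"
      using Q unfolding eventually_nhds_metric dist_real_def by blast
    have "eventually (\<lambda>n. P (count_list (l n) True / length (l n))) sequentially"
      using freq P by (simp add: filterlim_iff)
    then have "eventually (\<lambda>n. \<forall>p\<in>{0..1}. \<forall>y\<in>{0..1}. \<epsilon> < \<bar>p - x\<bar> \<longrightarrow> \<bar>y - x\<bar> < \<delta> \<longrightarrow>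
        bern_lik p (l n) \<le> (\<rho>\<^sup>2) ^ length (l n) * bern_lik y (l n)) sequentially"
      using ev_len
    proof eventually_elim
      case (elim n)
      show ?case
      proof (intro ballI impI)
        fix p y assume p: "p \<in> {0..1}" and "y \<in> {0..1}" and px: "\<epsilon> < \<bar>p - x\<bar>" and yx: "\<bar>y - x\<bar> < \<delta>"
        define s where "s = count_list (l n) True / length (l n)"
        have G: "G (s, y) < \<epsilon>\<^sup>2 / 16" and y: "y \<in> {0<..<1}"
          using PQ[of s y] elim \<delta>(2)[OF yx] by (auto simp: s_def)
        have "s * sqrt (p / y) + (1 - s) * sqrt ((1 - p) / (1 - y))
            = sqrt (x * p) + sqrt ((1 - x) * (1 - p)) +
              (s / sqrt y - sqrt x) * sqrt p + ((1 - s) / sqrt (1 - y) - sqrt (1 - x)) * sqrt (1 - p)"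
          unfolding real_sqrt_mult real_sqrt_divide by (simp add: algebra_simps)
        also have "\<dots> \<le> (1 - (x - p)\<^sup>2 / 8) + \<bar>s / sqrt y - sqrt x\<bar> * 1
             + \<bar>(1 - s) / sqrt (1 - y) - sqrt (1 - x)\<bar> * 1"
          using x p by (intro add_mono bhattacharyya_le mult_mono) auto
        also have "\<dots> = 1 - (x - p)\<^sup>2 / 8 + G (s, y)" by (simp add: G_def)
        also have "\<epsilon>\<^sup>2 \<le> (x - p)\<^sup>2"
          using px \<epsilon> by (metis abs_le_square_iff abs_minus_commute abs_of_pos less_imp_le)
        then have "1 - (x - p)\<^sup>2 / 8 + G (s, y) \<le> \<rho>"
          using G unfolding \<rho>_def by linarith
        finally show "bern_lik p (l n) \<le> (\<rho>\<^sup>2) ^ length (l n) * bern_lik y (l n)"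
          using elim y p by (intro bern_lik_ratio_le[OF _ _ _ s_def]) auto
      qed
    qed
    moreover have "0 \<le> \<rho>\<^sup>2" "\<rho>\<^sup>2 < 1" using \<rho> by (auto simp: power_less_one_iff)
    ultimately show ?thesis using \<delta>(1) that by blast
  next
    case False
    \<comment> \<open>At an endpoint, \<open>pos\<close> forces all observations to be equal, so
      each likelihood is a pure power. Its base is at most 1 - \<epsilon> far from \<open>x\<close>
      and at least 1 - \<delta> near it, with \<delta> < \<epsilon>. The \<open>max\<close> and
      \<open>min\<close> cover \<epsilon> \<ge> 1.\<close>
    define \<rho> where "\<rho> = max 0 (1 - \<epsilon>) / (1 - min \<epsilon> 1 / 2)"
    define \<delta> where "\<delta> = min \<epsilon> 1 / 2"
    have d: "0 < \<delta>" "\<delta> \<le> 1/2" "\<delta> < \<epsilon>" using \<epsilon> by (auto simp: \<delta>_def)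
    have \<rho>: "0 \<le> \<rho>" "\<rho> < 1" using \<epsilon> by (auto simp: \<rho>_def min_def max_def field_simps)
    have \<rho>1: "\<rho> * (1 - \<delta>) = max 0 (1 - \<epsilon>)" using d by (simp add: \<rho>_def \<delta>_def)
    have "bern_lik p (l n) \<le> \<rho> ^ length (l n) * bern_lik y (l n)"
      if p: "p \<in> {0..1}" and y: "y \<in> {0..1}" and px: "\<epsilon> < \<bar>p - x\<bar>" and yx: "\<bar>y - x\<bar> < \<delta>" for n p y
    proof -
      have ab: "count_list (l n) True + count_list (l n) False = length (l n)"
        by (rule count_list_True_False)
      have *: "q ^ N \<le> \<rho> ^ N * z ^ N" if "0 \<le> q" "q \<le> max 0 (1 - \<epsilon>)" "1 - \<delta> \<le> z" for q z N
      proof -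
        have "q ^ N \<le> (\<rho> * (1 - \<delta>)) ^ N" using that by (intro power_mono) (auto simp: \<rho>1)
        also have "\<dots> \<le> (\<rho> * z) ^ N" using that \<rho> d by (intro power_mono mult_left_mono) auto
        finally show ?thesis by (simp add: power_mult_distrib)
      qed
      from False x consider "x = 0" | "x = 1" by fastforce
      then show ?thesis
      proof cases
        case 1
        then have "count_list (l n) True = 0"
          using pos[of n] by (auto simp: bern_lik_eq power_0_left split: if_splits)
        then show ?thesis using ab p y px yx 1 by (auto simp: bern_lik_eq intro!: *)
      next
        case 2
        then have "count_list (l n) False = 0"
          using pos[of n] by (auto simp: bern_lik_eq power_0_left split: if_splits)
        then show ?thesis using ab p y px yx 2 by (auto simp: bern_lik_eq intro!: *)
      qed
    qed
    then show ?thesis using \<rho> d(1) by (intro that[of \<rho> \<delta>]) auto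
  qed
  define A where "A = {y. \<bar>y - x\<bar> < \<delta>}"
  have oA: "open A" unfolding A_def by (intro open_Collect_less continuous_intros)
  then have [measurable]: "A \<in> sets borel" by simp
  have "0 < emeasure \<mu> A" using supp oA \<delta> by (auto simp: msupport_def A_def)
  then have A: "0 < prob A" by (simp add: emeasure_eq_measure)
  have "eventually (\<lambda>n. measure (bayes \<mu> (l n)) {p. \<epsilon> < \<bar>p - x\<bar>} \<le> \<rho> ^ length (l n) / prob A) sequentially"
    using ev
  proof eventually_elim
    case (elim n)
    let ?Z = "\<integral>q. bern_lik q (l n) \<partial>\<mu>" and ?c = "\<rho> ^ length (l n)"
    have Z: "0 < ?Z" by (rule integral_bern_lik_pos[OF \<mu> supp pos])
    \<comment> \<open>Integrating the comparison over \<open>y\<close> in \<open>A\<close> bounds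
      the likelihood at \<open>p\<close> by the evidence \<open>?Z\<close>, at the price of the
      fixed factor \<open>prob A\<close>.\<close>
    have pt: "bern_lik p (l n) \<le> ?c * ?Z / prob A" if p: "p \<in> {0..1}" "\<epsilon> < \<bar>p - x\<bar>" for p
    proof -
      have "bern_lik p (l n) * prob A = (\<integral>y. bern_lik p (l n) * indicator A y \<partial>\<mu>)" by simp
      also have "\<dots> \<le> (\<integral>y. ?c * bern_lik y (l n) \<partial>\<mu>)"
      proof (rule integral_mono_AE)
        show "AE y in \<mu>. bern_lik p (l n) * indicator A y \<le> ?c * bern_lik y (l n)"
          using AE\<mu>
        proof eventually_elim
          case (elim y)
          then show ?case
            using \<open>\<forall>p\<in>{0..1}. _\<close> p \<rho> by (auto simp: indicator_def A_def bern_lik_nonneg)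
        qed
        show "integrable \<mu> (\<lambda>y. bern_lik p (l n) * indicator A y)"
          by (intro integrable_real_mult_indicator) auto
      qed (auto intro!: integrable_bern_lik \<mu>)
      finally show ?thesis using A by (simp add: field_simps)
    qed
    have "(\<integral>p. indicator {p. \<epsilon> < \<bar>p - x\<bar>} p * bern_lik p (l n) \<partial>\<mu>) \<le> (\<integral>p. ?c * ?Z / prob A \<partial>\<mu>)"
    proof (rule integral_mono_AE)
      show "integrable \<mu> (\<lambda>p. indicator {p. \<epsilon> < \<bar>p - x\<bar>} p * bern_lik p (l n))"
        by (rule integrable_const_bound[of _ 1])
           (auto simp: bern_lik_nonneg bern_lik_le_1 abs_mult indicator_def)
      show "AE p in \<mu>. indicator {p. \<epsilon> < \<bar>p - x\<bar>} p * bern_lik p (l n) \<le> ?c * ?Z / prob A"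
        using AE\<mu> by eventually_elim (use pt \<rho> Z in \<open>auto simp: indicator_def\<close>)
    qed auto
    then show ?case using Z A prob_space
      by (subst measure_bayes[OF \<mu> _ Z]) (auto simp: field_simps)
  qed
  moreover have "(\<lambda>n. \<rho> ^ length (l n) / prob A) \<longlonglongrightarrow> 0"
    using filterlim_compose[OF LIMSEQ_power_zero len, of \<rho>] \<rho> by (intro tendsto_divide_zero) auto
  ultimately show "(\<lambda>n. measure (bayes \<mu> (l n)) {p. \<epsilon> < \<bar>p - x\<bar>}) \<longlonglongrightarrow> 0"
    using tendsto_sandwich[of "\<lambda>_. 0" "\<lambda>n. measure (bayes \<mu> (l n)) {p. \<epsilon> < \<bar>p - x\<bar>}" sequentially
        "\<lambda>n. \<rho> ^ length (l n) / prob A" 0] by simp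
qed

text \<open>The limit cdf jumps only at \<open>a\<close>, so a continuity point \<open>x\<close>
  differs from \<open>a\<close>. Half the distance between them serves as tolerance: the half-line
  bounded by \<open>x\<close> and not containing \<open>a\<close> lies in the deviation
  event.\<close>

lemma concentrates_at_imp_weak_conv:
  assumes D: "\<And>n. real_distribution (D n)" and conc: "concentrates_at D a"
  shows "weak_conv_m D (return borel a)"
  unfolding weak_conv_m_def weak_conv_def
proof (intro allI impI)
  fix x assume cont: "isCont (cdf (return borel a)) x"
  have cdf: "cdf (return borel a) = (\<lambda>x. if a \<le> x then 1 else 0)"
    by (auto simp: cdf_def measure_return)
  have "x \<noteq> a"
  proof
    assume "x = a"
    then obtain d where d: "0 < d" "\<And>y. dist y a < d \<Longrightarrow> dist (cdf (return borel a) y) (cdf (return borel a) a) < 1"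
      using cont[unfolded continuous_at_eps_delta, rule_format, of 1] by auto
    show False using d(1) d(2)[of "a - d / 2"] by (simp add: cdf dist_real_def)
  qed
  define e where "e = \<bar>x - a\<bar> / 2"
  have e: "0 < e" using \<open>x \<noteq> a\<close> by (simp add: e_def)
  have lim: "(\<lambda>n. measure (D n) {y. e < \<bar>y - a\<bar>}) \<longlonglongrightarrow> 0"
    using conc e by (simp add: concentrates_at_def)
  show "(\<lambda>n. cdf (D n) x) \<longlonglongrightarrow> cdf (return borel a) x"
  proof (cases "x < a")
    case True
    have "cdf (D n) x \<le> measure (D n) {y. e < \<bar>y - a\<bar>}" for n
    proof -
      interpret real_distribution "D n" by (rule D)
      show ?thesis unfolding cdf_def using True by (intro finite_measure_mono) (auto simp: e_def)
    qed
    then have "(\<lambda>n. cdf (D n) x) \<longlonglongrightarrow> 0"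
      using tendsto_sandwich[OF _ _ tendsto_const lim, of "\<lambda>n. cdf (D n) x"] by (simp add: cdf_def)
    then show ?thesis using True by (simp add: cdf)
  next
    case False
    have "1 - measure (D n) {y. e < \<bar>y - a\<bar>} \<le> cdf (D n) x" "cdf (D n) x \<le> 1" for n
    proof -
      interpret real_distribution "D n" by (rule D)
      have "prob {x<..} \<le> prob {y. e < \<bar>y - a\<bar>}"
        using False \<open>x \<noteq> a\<close> by (intro finite_measure_mono) (auto simp: e_def)
      moreover have "prob {..x} = 1 - prob {x<..}"
        using prob_compl[of "{x<..}"] by (simp add: Compl_eq_Diff_UNIV[symmetric])
      ultimately show "1 - measure (D n) {y. e < \<bar>y - a\<bar>} \<le> cdf (D n) x" "cdf (D n) x \<le> 1"
        by (auto simp: cdf_def)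
    qed
    moreover have "(\<lambda>n. 1 - measure (D n) {y. e < \<bar>y - a\<bar>}) \<longlonglongrightarrow> 1"
      using tendsto_diff[OF tendsto_const lim, of 1] by simp
    ultimately have "(\<lambda>n. cdf (D n) x) \<longlonglongrightarrow> 1"
      using tendsto_sandwich[of "\<lambda>n. 1 - measure (D n) {y. e < \<bar>y - a\<bar>}" "\<lambda>n. cdf (D n) x" sequentially "\<lambda>_. 1" 1]
      by simp
    then show ?thesis using False \<open>x \<noteq> a\<close> by (simp add: cdf)
  qed
qed

lemma eventually_const_imp_weak_conv:
  assumes "eventually (\<lambda>n. D n = L) sequentially"
  shows "weak_conv_m D L"
  unfolding weak_conv_m_def weak_conv_def
  by (auto intro!: tendsto_eventually eventually_mono[OF assms])

text \<open>This is the relative entropy of Bernoulli(y) with respect to Bernoulli(x). Apply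
  \<open>ln t \<le> t - 1\<close> to both ratios, strictly to the first; the linear bounds
  \<open>x - y\<close> and \<open>y - x\<close> cancel.\<close>

lemma relative_entropy_pos:
  fixes x y :: real
  assumes "x \<in> {0<..<1}" "y \<in> {0<..<1}" "x \<noteq> y"
  shows "0 < y * (ln y - ln x) + (1 - y) * (ln (1 - y) - ln (1 - x))"
proof -
  have "ln (x / y) \<noteq> x / y - 1" using assms ln_eq_minus_one[of "x / y"] by auto
  then have "ln (x / y) < x / y - 1" using assms ln_le_minus_one[of "x / y"] by simp
  then have "y * (ln x - ln y) < y * (x / y - 1)" using assms by (simp add: ln_div)
  also have "\<dots> = x - y" using assms by (simp add: field_simps)
  finally have "y * (ln x - ln y) < x - y" .
  moreover have "(1 - y) * (ln (1 - x) - ln (1 - y)) \<le> (1 - y) * ((1 - x) / (1 - y) - 1)"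
    using assms ln_le_minus_one[of "(1 - x) / (1 - y)"] by (intro mult_left_mono) (auto simp: ln_div)
  moreover have "(1 - y) * ((1 - x) / (1 - y) - 1) = y - x" using assms by (simp add: field_simps)
  ultimately show ?thesis using assms by (simp add: algebra_simps)
qed

lemma bern_lik_eq_exp:
  assumes "x \<in> {0<..<1}"
  shows "bern_lik x l = exp (count_list l True * ln x + count_list l False * ln (1 - x))"
  using assms by (simp add: bern_lik_eq exp_add exp_of_nat_mult)

text \<open>At frequency exactly \<open>y\<close> the log-likelihood ratio is the length times the
  relative entropy. Moving the frequency beyond \<open>y\<close>, away from \<open>x\<close>, which
  is what \<open>dev\<close> says, can only increase it: its slope \<open>?a - ?b\<close> has the
  sign of \<open>y - x\<close>.\<close>

lemma exp_le_bern_lik_ratio: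
  fixes x y :: real
  assumes x: "x \<in> {0<..<1}" and y: "y \<in> {0<..<1}"
    and dev: "0 \<le> (y - x) * (count_list l True - y * length l)"
  shows "exp ((y * (ln y - ln x) + (1 - y) * (ln (1 - y) - ln (1 - x))) * length l)
    \<le> bern_lik y l / bern_lik x l"
proof -
  let ?a = "ln y - ln x" and ?b = "ln (1 - y) - ln (1 - x)"
  let ?T = "real (count_list l True)" and ?F = "real (count_list l False)" and ?k = "real (length l)"
  have k: "?k = ?T + ?F" using count_list_True_False[of l] by simp
  have "0 \<le> (?T - y * ?k) * (?a - ?b)"
  proof (cases y x rule: linorder_cases)
    case less
    then have "?a \<le> ?b" using x y by (intro order_trans[of ?a 0 ?b]) auto
    moreover have "?T - y * ?k \<le> 0" using dev less by (auto simp: zero_le_mult_iff)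
    ultimately show ?thesis by (intro mult_nonpos_nonpos) auto
  next
    case greater
    then have "?b \<le> ?a" using x y by (intro order_trans[of ?b 0 ?a]) auto
    moreover have "0 \<le> ?T - y * ?k" using dev greater by (auto simp: zero_le_mult_iff)
    ultimately show ?thesis by (intro mult_nonneg_nonneg) auto
  qed auto
  then have "(y * ?a + (1 - y) * ?b) * ?k \<le> ?T * ?a + ?F * ?b"
    unfolding k by (simp add: algebra_simps)
  then show ?thesis
    using x y by (simp add: bern_lik_eq_exp exp_diff[symmetric] algebra_simps)
qed

subsection \<open>Topological support\<close>

lemma closed_msupport: "closed (msupport N)"
proof -
  have "- msupport N = \<Union>{U. open U \<and> emeasure N U = 0}"
    by (auto simp: msupport_def zero_less_iff_neq_zero)
  then show ?thesis by (auto simp: closed_def)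
qed

text \<open>An empty support would cover the space by open null sets; by Lindelof countably many
  suffice, so the space would be null.\<close>

lemma msupport_nonempty:
  fixes N :: "'a::second_countable_topology measure"
  assumes "sets N = sets borel" "emeasure N UNIV \<noteq> 0"
  shows "msupport N \<noteq> {}"
proof
  assume "msupport N = {}"
  then have UN: "\<Union>{U. open U \<and> emeasure N U = 0} = UNIV"
    by (auto simp: msupport_def set_eq_iff zero_less_iff_neq_zero)
  obtain F where F: "F \<subseteq> {U. open U \<and> emeasure N U = 0}" "countable F" "\<Union>F = \<Union>{U. open U \<and> emeasure N U = 0}"
    using Lindelof[of "{U. open U \<and> emeasure N U = 0}"] by blast
  have "(\<Union>U\<in>F. U) \<in> null_sets N"
    using F assms(1) by (intro null_sets_UN') (auto simp: null_sets_def)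
  then show False using F(3) UN assms(2) by (simp add: null_sets_def)
qed

subsection \<open>Records of a round\<close>

definition obs_fit :: "nat \<Rightarrow> round_record \<Rightarrow> bool option" where
  "obs_fit j r = fst r j"

definition obs_quality :: "nat \<Rightarrow> round_record \<Rightarrow> bool option" where
  "obs_quality j r = (case snd r of Some (k, b) \<Rightarrow> if k = j then Some b else None | None \<Rightarrow> None)"

lemma inspected_Nil [simp]: "inspected [] f = {}"
  and inspected_Cons [simp]: "inspected (j # js) f = (if f j then {j} else insert j (inspected js f))"
  by (auto simp: inspected_def)

lemma inspected_subset: "inspected js f \<subseteq> set js"
  by (induction js) auto

lemma find_inspected: "find f js = Some j \<longleftrightarrow> j \<in> inspected js f \<and> f j"
  by (induction js) (auto split: if_splits)

lemma inspected_cong: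
  assumes "\<forall>k\<in>inspected js f. f k = g k"
  shows "inspected js f = inspected js g" "find f js = find g js"
  using assms by (induction js) (auto split: if_splits)

lemma inspected_all_unfit: "\<forall>k\<in>set js. \<not> f k \<Longrightarrow> inspected js f = set js"
  by (induction js) auto

text \<open>The search ends at the first fit, so an inspected business that fits is the one
  transacted with. Its quality is thus seen exactly then.\<close>

lemma obs_search_record:
  "obs_fit j (search_record js f q) = (if j \<in> inspected js f then Some (f j) else None)"
  "obs_quality j (search_record js f q) = (if j \<in> inspected js f \<and> f j then Some (q j) else None)"
  using find_inspected[of f js j]
  by (cases "find f js"; auto simp: obs_fit_def obs_quality_def search_record_def)+

definition consistent :: "'a option \<Rightarrow> 'a set" where
  "consistent ob = (case ob of None \<Rightarrow> UNIV | Some b \<Rightarrow> {b})"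

definition attainable :: "nat list \<Rightarrow> round_record \<Rightarrow> bool" where
  "attainable js r \<longleftrightarrow> (\<exists>f q. search_record js f q = r)"

text \<open>Fits outside the inspected set cannot influence the search, so agreement with the
  recorded entries suffices once some run produces \<open>r\<close>. The event of a record becomes a
  rectangle in value, fits and qualities, and its probability a product.\<close>

lemma search_record_eq_iff:
  assumes js: "set js \<subseteq> {..<m}"
  shows "search_record js f q = r \<longleftrightarrow> attainable js r \<and>
    (\<forall>k\<in>{..<m}. f k \<in> consistent (obs_fit k r)) \<and> (\<forall>k\<in>{..<m}. q k \<in> consistent (obs_quality k r))"
proof (intro iffI conjI ballI; (elim conjE)?)
  assume f: "\<forall>k\<in>{..<m}. f k \<in> consistent (obs_fit k r)"
    and q: "\<forall>k\<in>{..<m}. q k \<in> consistent (obs_quality k r)"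
    and "attainable js r"
  then obtain f' q' where r: "r = search_record js f' q'" by (auto simp: attainable_def)
  have ins: "k < m" if "k \<in> inspected js f'" for k
    using that inspected_subset js by blast
  have ff: "\<forall>k\<in>inspected js f'. f' k = f k"
  proof
    fix k assume k: "k \<in> inspected js f'"
    then have "f k \<in> consistent (obs_fit k r)" using f ins by blast
    then show "f' k = f k" using k by (simp add: r obs_search_record consistent_def)
  qed
  note eq = inspected_cong[OF ff]
  have "q' k = q k" if "find f' js = Some k" for k
  proof -
    have k: "k \<in> inspected js f'" "f' k" using that by (auto simp: find_inspected)
    then have "q k \<in> consistent (obs_quality k r)" using q ins by blast
    then show ?thesis using k by (simp add: r obs_search_record consistent_def)
  qed
  then show "search_record js f q = r"
    using eq ff by (auto simp: r search_record_def fun_eq_iff map_option_case split: option.splits)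
qed (auto simp: attainable_def obs_search_record consistent_def split: if_splits)

text \<open>A finite superset of the records that can occur. It reduces expectations over histories
  to finite sums, so no conditional expectations are needed.\<close>

definition records :: "nat \<Rightarrow> round_record set" where
  "records m = {r. dom (fst r) \<subseteq> {..<m} \<and> fst ` set_option (snd r) \<subseteq> {..<m}}"

lemma search_record_in_records:
  assumes "set js \<subseteq> {..<m}" shows "search_record js f q \<in> records m"
proof -
  have "inspected js f \<subseteq> {..<m}" using inspected_subset assms by blast
  moreover from this have "find f js = Some k \<Longrightarrow> k < m" for k by (auto simp: find_inspected)
  ultimately show ?thesis
    by (auto simp: records_def search_record_def split: if_splits)
qed

lemma finite_records: "finite (records m)"
proof -
  let ?F = "\<Union>A\<in>Pow {..<m}. {g :: nat \<rightharpoonup> bool. dom g = A \<and> ran g \<subseteq> UNIV}"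
  have "records m \<subseteq> ?F \<times> insert None (Some ` ({..<m} \<times> UNIV))"
  proof
    fix r assume "r \<in> records m"
    then obtain g t where r: "r = (g, t)" "dom g \<subseteq> {..<m}" "fst ` set_option t \<subseteq> {..<m}"
      by (cases r) (auto simp: records_def)
    have "t \<in> insert None (Some ` ({..<m} \<times> UNIV))"
      using r(3) by (cases t) (auto simp: image_iff)
    moreover have "g \<in> ?F" using r(2) by auto
    ultimately show "r \<in> ?F \<times> insert None (Some ` ({..<m} \<times> UNIV))" using r(1) by blast
  qed
  moreover have "finite ?F"
    by (intro finite_UN_I finite_set_of_finite_maps) (auto intro: finite_subset)
  ultimately show ?thesis
    by (auto intro: finite_subset)
qed

section \<open>Measurability of the search order as a function of the value\<close>

lemma measurable_insort_key:
  fixes k :: "'b \<Rightarrow> 'a::countable \<Rightarrow> real"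
  assumes [measurable]: "\<And>x. (\<lambda>v. k v x) \<in> borel_measurable N"
  shows "(\<lambda>v. insort_key (k v) x ys) \<in> N \<rightarrow>\<^sub>M count_space UNIV"
proof (induction ys)
  case (Cons y ys)
  note Cons.IH[measurable]
  have "(\<lambda>v. y # insort_key (k v) x ys) \<in> N \<rightarrow>\<^sub>M count_space UNIV"
    by (rule measurable_compose[OF Cons.IH]) simp
  then show ?case by simp
qed simp

lemma measurable_sort_key:
  fixes k :: "'b \<Rightarrow> 'a::countable \<Rightarrow> real"
  assumes k [measurable]: "\<And>x. (\<lambda>v. k v x) \<in> borel_measurable N"
    and xs: "xs \<in> N \<rightarrow>\<^sub>M count_space UNIV"
  shows "(\<lambda>v. sort_key (k v) (xs v)) \<in> N \<rightarrow>\<^sub>M count_space UNIV"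
proof (rule measurable_compose_countable[OF _ xs])
  fix ys show "(\<lambda>v. sort_key (k v) ys) \<in> N \<rightarrow>\<^sub>M count_space UNIV"
  proof (induction ys)
    case (Cons y ys)
    have "(\<lambda>v. insort_key (k v) y (sort_key (k v) ys)) \<in> N \<rightarrow>\<^sub>M count_space UNIV"
      by (rule measurable_compose_countable[OF measurable_insort_key[OF k] Cons.IH])
    then show ?case by simp
  qed simp
qed

lemma measurable_filter:
  fixes P :: "'b \<Rightarrow> 'a::countable \<Rightarrow> bool"
  assumes [measurable]: "\<And>x. Measurable.pred N (\<lambda>v. P v x)"
    and xs: "xs \<in> N \<rightarrow>\<^sub>M count_space UNIV"
  shows "(\<lambda>v. filter (P v) (xs v)) \<in> N \<rightarrow>\<^sub>M count_space UNIV"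
proof (rule measurable_compose_countable[OF _ xs])
  fix ys show "(\<lambda>v. filter (P v) ys) \<in> N \<rightarrow>\<^sub>M count_space UNIV"
  proof (induction ys)
    case (Cons y ys)
    note Cons.IH[measurable]
    have "(\<lambda>v. y # filter (P v) ys) \<in> N \<rightarrow>\<^sub>M count_space UNIV"
      by (rule measurable_compose[OF Cons.IH]) simp
    then show ?case by simp
  qed simp
qed

lemma sets_value_dist [simp, measurable_cong]: "sets (value_dist M) = sets borel"
  and space_value_dist [simp]: "space (value_dist M) = UNIV"
  by (simp_all add: value_dist_def)

section \<open>Probabilities of rounds and likelihoods of histories\<close>

definition weight :: "real \<Rightarrow> bool option \<Rightarrow> real" where
  "weight x ob = measure (measure_pmf (bernoulli_pmf x)) (consistent ob)"

lemma weight_simps [simp]: "weight x None = 1" "weight x (Some b) = pmf (bernoulli_pmf x) b"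
  by (simp_all add: weight_def consistent_def measure_pmf_single)

definition outcomes :: "('a \<Rightarrow> bool option) \<Rightarrow> 'a list \<Rightarrow> bool list" where
  "outcomes ob h = List.map_filter ob h"

lemma outcomes_Nil [simp]: "outcomes ob [] = []"
  and outcomes_append [simp]: "outcomes ob (h @ h') = outcomes ob h @ outcomes ob h'"
  and outcomes_single [simp]: "outcomes ob [r] = (case ob r of None \<Rightarrow> [] | Some b \<Rightarrow> [b])"
  by (auto simp: outcomes_def List.map_filter_def split: option.splits)

lemma weight_outcomes_single: "weight x (ob r) = bern_lik x (outcomes ob [r])"
  by (auto split: option.splits)

lemma prob_space_value_dist: "valid_market M \<Longrightarrow> prob_space (value_dist M)"
  by (simp add: valid_market_def)

text \<open>The transition kernel of the history under parameters \<theta>. The belief inside is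
  that of the consumers and a function of \<open>h\<close> alone, so \<theta> enters only through
  the law of the shock.\<close>

definition step :: "market \<Rightarrow> params \<Rightarrow> history \<Rightarrow> round_record \<Rightarrow> real" where
  "step M \<theta> h r = measure (shock_dist M \<theta>)
     {s \<in> space (shock_dist M \<theta>). round_outcome M (posterior M (hist M (length h)) h) h s = r}"

locale market_model =
  fixes M :: market
  assumes valid: "valid_market M"
begin

lemma set_search_order: "set (search_order M B h v) = {j. j < num_businesses M \<and> 0 < belief_index M B j v}"
proof -
  have "set (tie_order M h v) = {..<num_businesses M}"
    using valid unfolding valid_market_def by blast
  then show ?thesis by (simp add: search_order_def)
qed

lemma measurable_search_order: "search_order M B h \<in> borel \<rightarrow>\<^sub>M count_space UNIV"
proof -
  have [measurable]: "(\<lambda>v. belief_index M B j v) \<in> borel_measurable borel" for j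
    by (simp add: belief_index_def index_def)
  have [measurable]: "tie_order M h \<in> borel \<rightarrow>\<^sub>M count_space UNIV"
    using valid by (simp add: valid_market_def)
  show ?thesis
    unfolding search_order_def by (intro measurable_sort_key measurable_filter) measurable
qed

lemma prob_space_shock_dist: "prob_space (shock_dist M \<theta>)"
  unfolding shock_dist_def
  by (intro prob_space_pair prob_space_value_dist valid prob_space_PiM measure_pmf.prob_space_axioms)

lemma round_outcome_in_records: "round_outcome M B h s \<in> records (num_businesses M)"
  by (auto simp: round_outcome_def set_search_order intro!: search_record_in_records split: prod.split)

lemma round_outcome_event:
  "{s \<in> space (shock_dist M \<theta>). round_outcome M B h s = r} =
    {v. attainable (search_order M B h v) r} \<times>
    {f \<in> space (\<Pi>\<^sub>M j\<in>{..<num_businesses M}. measure_pmf (bernoulli_pmf (fst \<theta> j))).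
       \<forall>k\<in>{..<num_businesses M}. f k \<in> consistent (obs_fit k r)} \<times>
    {q \<in> space (\<Pi>\<^sub>M j\<in>{..<num_businesses M}. measure_pmf (bernoulli_pmf (snd \<theta> j))).
       \<forall>k\<in>{..<num_businesses M}. q k \<in> consistent (obs_quality k r)}"
proof -
  have js: "set (search_order M B h v) \<subseteq> {..<num_businesses M}" for v
    by (auto simp: set_search_order)
  show ?thesis
    by (intro set_eqI, simp add: shock_dist_def space_pair_measure round_outcome_def
        search_record_eq_iff[OF js] split: prod.split) blast
qed

lemma value_event_sets: "{v. attainable (search_order M B h v) r} \<in> sets borel"
proof -
  have "{v. attainable (search_order M B h v) r} =
    search_order M B h -` {js. attainable js r} \<inter> space borel" by auto
  also have "\<dots> \<in> sets borel"
    by (rule measurable_sets[OF measurable_search_order]) simp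
  finally show ?thesis .
qed

lemma bernoulli_event_sets:
  "{f \<in> space (\<Pi>\<^sub>M j\<in>{..<m::nat}. measure_pmf (bernoulli_pmf (p j))). \<forall>k\<in>{..<m}. f k \<in> A k} \<in>
    sets (\<Pi>\<^sub>M j\<in>{..<m}. measure_pmf (bernoulli_pmf (p j)))"
  by measurable

lemma bernoulli_event_measure:
  "emeasure (\<Pi>\<^sub>M j\<in>{..<m::nat}. measure_pmf (bernoulli_pmf (p j)))
    {f \<in> space (\<Pi>\<^sub>M j\<in>{..<m}. measure_pmf (bernoulli_pmf (p j))). \<forall>k\<in>{..<m}. f k \<in> A k} =
    (\<Prod>k<m. emeasure (measure_pmf (bernoulli_pmf (p k))) (A k))"
proof -
  interpret product_prob_space "\<lambda>j. measure_pmf (bernoulli_pmf (p j))" "{..<m}"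
    by unfold_locales
  show ?thesis by (rule emeasure_PiM_Collect) auto
qed

lemma round_event_sets: "{s \<in> space (shock_dist M \<theta>). round_outcome M B h s = r} \<in> sets (shock_dist M \<theta>)"
  unfolding round_outcome_event unfolding shock_dist_def
  by (intro pair_measureI bernoulli_event_sets) (simp add: value_event_sets)

lemma emeasure_shock_Times:
  assumes "A \<in> sets borel"
  shows "emeasure (shock_dist M \<theta>) (A \<times>
    {f \<in> space (\<Pi>\<^sub>M j\<in>{..<num_businesses M}. measure_pmf (bernoulli_pmf (fst \<theta> j))).
       \<forall>k\<in>{..<num_businesses M}. f k \<in> F k} \<times>
    {q \<in> space (\<Pi>\<^sub>M j\<in>{..<num_businesses M}. measure_pmf (bernoulli_pmf (snd \<theta> j))).
       \<forall>k\<in>{..<num_businesses M}. q k \<in> G k}) =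
    emeasure (value_dist M) A * ((\<Prod>k<num_businesses M. emeasure (measure_pmf (bernoulli_pmf (fst \<theta> k))) (F k)) *
      (\<Prod>k<num_businesses M. emeasure (measure_pmf (bernoulli_pmf (snd \<theta> k))) (G k)))"
proof -
  let ?F = "\<Pi>\<^sub>M j\<in>{..<num_businesses M}. measure_pmf (bernoulli_pmf (fst \<theta> j))"
  let ?G = "\<Pi>\<^sub>M j\<in>{..<num_businesses M}. measure_pmf (bernoulli_pmf (snd \<theta> j))"
  interpret G: prob_space ?G by (intro prob_space_PiM measure_pmf.prob_space_axioms)
  interpret FG: prob_space "?F \<Otimes>\<^sub>M ?G"
    by (intro prob_space_pair prob_space_PiM measure_pmf.prob_space_axioms)
  show ?thesis
    unfolding shock_dist_def using assms
    by (simp add: FG.emeasure_pair_measure_Times G.emeasure_pair_measure_Times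
        bernoulli_event_sets bernoulli_event_measure pair_measureI)
qed

text \<open>All consumer behaviour sits in the value factor, which is free of \<theta>. It therefore
  cancels in posteriors and likelihood ratios, despite the adaptive search.\<close>

lemma measure_round_outcome:
  "measure (shock_dist M \<theta>) {s \<in> space (shock_dist M \<theta>). round_outcome M B h s = r} =
    measure (value_dist M) {v. attainable (search_order M B h v) r} *
    (\<Prod>k<num_businesses M. weight (fst \<theta> k) (obs_fit k r)) *
    (\<Prod>k<num_businesses M. weight (snd \<theta> k) (obs_quality k r))"
proof -
  interpret V: prob_space "value_dist M" by (rule prob_space_value_dist[OF valid])
  show ?thesis
    unfolding round_outcome_event measure_def emeasure_shock_Times[OF value_event_sets]
    by (simp add: V.emeasure_eq_measure measure_pmf.emeasure_eq_measure weight_def prod_ennreal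
        enn2real_mult prod_nonneg)
qed

lemma step_nonneg: "0 \<le> step M \<theta> h r"
  by (simp add: step_def)

lemma sum_step: "(\<Sum>r\<in>records (num_businesses M). step M \<theta> h r) = 1"
proof -
  interpret prob_space "shock_dist M \<theta>" by (rule prob_space_shock_dist)
  let ?f = "round_outcome M (posterior M (hist M (length h)) h) h"
  have "(\<Sum>r\<in>records (num_businesses M). step M \<theta> h r) =
    prob (\<Union>r\<in>records (num_businesses M). {s \<in> space (shock_dist M \<theta>). ?f s = r})"
    unfolding step_def
    by (rule finite_measure_finite_Union[symmetric])
       (auto simp: finite_records disjoint_family_on_def intro: round_event_sets)
  also have "(\<Union>r\<in>records (num_businesses M). {s \<in> space (shock_dist M \<theta>). ?f s = r}) = space (shock_dist M \<theta>)"
    by (auto simp: round_outcome_in_records)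
  finally show ?thesis by (simp add: prob_space)
qed

text \<open>Once the target \<open>h\<close> is fixed, so are the beliefs of all its rounds. The
  recursion then unfolds into separate conditions on the coordinates of \<omega>, a cylinder
  event.\<close>

lemma hist_eq_iff:
  "hist M n \<omega> = h \<longleftrightarrow> length h = n \<and>
    (\<forall>i<n. round_outcome M (posterior M (hist M i) (take i h)) (take i h) (\<omega> i) = h ! i)"
proof (induction n arbitrary: h)
  case (Suc n)
  show ?case
  proof (cases h rule: rev_cases)
    case (snoc g r)
    have "hist M (Suc n) \<omega> = g @ [r] \<longleftrightarrow> hist M n \<omega> = g \<and>
        round_outcome M (posterior M (hist M n) g) g (\<omega> n) = r" by auto
    then show ?thesis
      unfolding snoc Suc.IH by (auto simp: less_Suc_eq nth_append)
  qed simp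
qed auto

lemma length_hist [simp]: "length (hist M n \<omega>) = n"
  using hist_eq_iff by blast

lemma set_hist: "set (hist M n \<omega>) \<subseteq> records (num_businesses M)"
  by (induction n) (auto simp: round_outcome_in_records)

lemma
  fixes \<theta> h
  defines "E \<equiv> {\<omega> \<in> space (sample_space M \<theta>). hist M (length h) \<omega> = h}"
  shows hist_eq_sets: "E \<in> sets (sample_space M \<theta>)"
    and measure_hist: "measure (sample_space M \<theta>) E = (\<Prod>i<length h. step M \<theta> (take i h) (h ! i))"
proof -
  interpret S: prob_space "shock_dist M \<theta>" by (rule prob_space_shock_dist)
  interpret P: product_prob_space "\<lambda>_::nat. shock_dist M \<theta>" UNIV by unfold_locales
  let ?X = "\<lambda>i. {s \<in> space (shock_dist M \<theta>).
    round_outcome M (posterior M (hist M i) (take i h)) (take i h) s = h ! i}"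
  have E: "E = {\<omega> \<in> space (PiM UNIV (\<lambda>_. shock_dist M \<theta>)). \<forall>i\<in>{..<length h}. \<omega> i \<in> ?X i}"
    unfolding E_def sample_space_def hist_eq_iff[of _ _ h]
    by (simp add: space_PiM PiE_iff cong: conj_cong) (blast dest: spec)
  have [measurable]: "?X i \<in> sets (shock_dist M \<theta>)" for i by (rule round_event_sets)
  show "E \<in> sets (sample_space M \<theta>)" unfolding E sample_space_def by measurable
  have "emeasure (sample_space M \<theta>) E = (\<Prod>i<length h. emeasure (shock_dist M \<theta>) (?X i))"
    unfolding E sample_space_def by (rule P.emeasure_PiM_Collect) auto
  also have "\<dots> = ennreal (\<Prod>i<length h. step M \<theta> (take i h) (h ! i))"
    by (simp add: step_def S.emeasure_eq_measure prod_ennreal min_absorb2)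
  finally show "measure (sample_space M \<theta>) E = (\<Prod>i<length h. step M \<theta> (take i h) (h ! i))"
    by (rule measure_eq_emeasure_eq_ennreal[rotated]) (simp add: prod_nonneg step_nonneg)
qed

lemma likelihood_eq_prod: "likelihood M (hist M (length h)) h \<theta> = (\<Prod>i<length h. step M \<theta> (take i h) (h ! i))"
  by (simp add: likelihood_def measure_hist)

lemma likelihood_Nil [simp]: "likelihood M (hist M 0) [] \<theta> = 1"
  using likelihood_eq_prod[of "[]" \<theta>] by simp

lemma likelihood_snoc:
  "likelihood M (hist M (Suc (length h))) (h @ [r]) \<theta> = likelihood M (hist M (length h)) h \<theta> * step M \<theta> h r"
  using likelihood_eq_prod[of "h @ [r]" \<theta>] by (simp add: likelihood_eq_prod[of h \<theta>] nth_append)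

lemma likelihood_nonneg: "0 \<le> likelihood M H h \<theta>"
  by (simp add: likelihood_def)

text \<open>\<open>C\<close> is the product over the rounds of the value factors from
  \<open>measure_round_outcome\<close>. It may be 0, namely when \<open>h\<close> cannot arise from
  the consumers' search.\<close>

lemma likelihood_factorization:
  obtains C where "0 \<le> C" "\<And>\<theta>. likelihood M (hist M (length h)) h \<theta> = C *
    (\<Prod>k<num_businesses M. bern_lik (fst \<theta> k) (outcomes (obs_fit k) h)) *
    (\<Prod>k<num_businesses M. bern_lik (snd \<theta> k) (outcomes (obs_quality k) h))"
proof (induction h arbitrary: thesis rule: rev_induct)
  case Nil
  show ?case by (rule Nil[of 1]) (simp_all del: hist.simps)
next
  case (snoc r h)
  obtain C where C: "0 \<le> C" "\<And>\<theta>. likelihood M (hist M (length h)) h \<theta> = C *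
    (\<Prod>k<num_businesses M. bern_lik (fst \<theta> k) (outcomes (obs_fit k) h)) *
    (\<Prod>k<num_businesses M. bern_lik (snd \<theta> k) (outcomes (obs_quality k) h))"
    using snoc.IH by blast
  define c where "c = measure (value_dist M)
    {v. attainable (search_order M (posterior M (hist M (length h)) h) h v) r}"
  show ?case
    by (rule snoc.prems[of "C * c"])
      (simp_all add: C(1) c_def likelihood_snoc C(2) step_def measure_round_outcome
        weight_outcomes_single bern_lik_append prod.distrib mult_ac del: hist.simps outcomes_single)
qed

subsection \<open>Posterior marginals\<close>

lemma
  assumes "k < num_businesses M"
  shows fit_prior: "real_distribution (fit_prior M k)" "AE x in fit_prior M k. x \<in> {0..1}"
      "fit_prob M k \<in> msupport (fit_prior M k)"
    and quality_prior: "real_distribution (quality_prior M k)" "AE x in quality_prior M k. x \<in> {0..1}"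
      "quality M k \<in> msupport (quality_prior M k)"
    and fit_prob_bounds: "fit_prob M k \<in> {0<..<1}"
    and quality_bounds: "quality M k \<in> {0..1}"
proof -
  have v: "fit_prob M k \<in> {0<..<1}" "quality M k \<in> {0..1}"
    "real_distribution (fit_prior M k)" "AE x in fit_prior M k. x \<in> {0<..<1}"
    "real_distribution (quality_prior M k)" "AE x in quality_prior M k. x \<in> {0..1}"
    "fit_prob M k \<in> msupport (fit_prior M k)" "quality M k \<in> msupport (quality_prior M k)"
    using valid assms unfolding valid_market_def by blast+
  show "AE x in fit_prior M k. x \<in> {0..1}" using v(4) by (rule eventually_mono) auto
qed (use valid assms in \<open>unfold valid_market_def, blast+\<close>)

text \<open>A nonempty closed bounded set contains its supremum. Hence every open set around the
  maximal value has positive probability, although a distribution with a density gives the point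
  itself mass 0.\<close>

lemma max_value_in_msupport: "max_value M \<in> msupport (value_dist M)"
proof -
  interpret prob_space "value_dist M" by (rule prob_space_value_dist[OF valid])
  have "msupport (value_dist M) \<noteq> {}"
    using emeasure_space_1 by (intro msupport_nonempty) auto
  then show ?thesis
    using valid unfolding max_value_def
    by (intro closed_contains_Sup closed_msupport) (auto simp: valid_market_def bounded_imp_bdd_above)
qed

lemma measurable_prior [measurable]:
  assumes "k < num_businesses M"
  shows "(\<lambda>\<theta>. fst \<theta> k) \<in> borel_measurable (prior M)"
    and "(\<lambda>\<theta>. snd \<theta> k) \<in> borel_measurable (prior M)"
proof -
  note sets = real_distribution.events_eq_borel[OF fit_prior(1)[OF assms]]
    real_distribution.events_eq_borel[OF quality_prior(1)[OF assms]]
  have "(\<lambda>f. f k) \<in> borel_measurable (\<Pi>\<^sub>M j\<in>{..<num_businesses M}. fit_prior M j)"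
    using measurable_component_singleton[of k "{..<num_businesses M}" "fit_prior M"] assms
    by (simp add: measurable_cong_sets[OF refl sets(1)])
  then show "(\<lambda>\<theta>. fst \<theta> k) \<in> borel_measurable (prior M)"
    unfolding prior_def by (rule measurable_compose[OF measurable_fst])
  have "(\<lambda>f. f k) \<in> borel_measurable (\<Pi>\<^sub>M j\<in>{..<num_businesses M}. quality_prior M j)"
    using measurable_component_singleton[of k "{..<num_businesses M}" "quality_prior M"] assms
    by (simp add: measurable_cong_sets[OF refl sets(2)])
  then show "(\<lambda>\<theta>. snd \<theta> k) \<in> borel_measurable (prior M)"
    unfolding prior_def by (rule measurable_compose[OF measurable_snd])
qed

lemma nn_integral_prior_prod:
  assumes F [measurable]: "\<And>k. F k \<in> borel_measurable borel"
    and G [measurable]: "\<And>k. G k \<in> borel_measurable borel"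
  shows "(\<integral>\<^sup>+\<theta>. (\<Prod>k<num_businesses M. F k (fst \<theta> k)) * (\<Prod>k<num_businesses M. G k (snd \<theta> k)) \<partial>prior M) =
    (\<Prod>k<num_businesses M. \<integral>\<^sup>+x. F k x \<partial>fit_prior M k) * (\<Prod>k<num_businesses M. \<integral>\<^sup>+x. G k x \<partial>quality_prior M k)"
proof -
  let ?m = "num_businesses M"
  \<comment> \<open>The product locale asks for a probability space at every index, but validity
    speaks only of indices below \<open>?m\<close>; point masses at 0 fill the rest.\<close>
  define \<mu> where "\<mu> k = (if k < ?m then fit_prior M k else return borel 0)" for k
  define \<nu> where "\<nu> k = (if k < ?m then quality_prior M k else return borel 0)" for k
  have ps: "prob_space (\<mu> k)" "prob_space (\<nu> k)" for k
    using fit_prior(1)[of k] quality_prior(1)[of k]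
    by (auto simp: \<mu>_def \<nu>_def real_distribution_def prob_space_return)
  have sets: "sets (\<mu> k) = sets borel" "sets (\<nu> k) = sets borel" for k
    using real_distribution.events_eq_borel[OF fit_prior(1)[of k]]
      real_distribution.events_eq_borel[OF quality_prior(1)[of k]]
    by (auto simp: \<mu>_def \<nu>_def)
  note [measurable_cong] = sets
  have prior: "prior M = PiM {..<?m} \<mu> \<Otimes>\<^sub>M PiM {..<?m} \<nu>"
    unfolding prior_def by (intro arg_cong2[of _ _ _ _ pair_measure] PiM_cong) (auto simp: \<mu>_def \<nu>_def)
  interpret \<mu>: prob_space "\<mu> k" for k by (rule ps)
  interpret \<nu>: prob_space "\<nu> k" for k by (rule ps)
  interpret P: product_prob_space \<mu> "{..<?m}" by unfold_locales
  interpret Q: product_prob_space \<nu> "{..<?m}" by unfold_locales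
  have meas [measurable]:
    "(\<lambda>f. \<Prod>k<?m. F k (f k)) \<in> borel_measurable (PiM {..<?m} \<mu>)"
    "(\<lambda>f. \<Prod>k<?m. G k (f k)) \<in> borel_measurable (PiM {..<?m} \<nu>)"
    by measurable
  have "(\<integral>\<^sup>+\<theta>. (\<Prod>k<?m. F k (fst \<theta> k)) * (\<Prod>k<?m. G k (snd \<theta> k)) \<partial>prior M) =
    (\<integral>\<^sup>+f. \<integral>\<^sup>+g. (\<Prod>k<?m. F k (f k)) * (\<Prod>k<?m. G k (g k)) \<partial>PiM {..<?m} \<nu> \<partial>PiM {..<?m} \<mu>)"
    unfolding prior
    by (subst Q.P.nn_integral_fst[symmetric]) auto
  also have "\<dots> = (\<integral>\<^sup>+f. (\<Prod>k<?m. F k (f k)) \<partial>PiM {..<?m} \<mu>) * (\<integral>\<^sup>+g. (\<Prod>k<?m. G k (g k)) \<partial>PiM {..<?m} \<nu>)"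
    by (simp add: nn_integral_cmult nn_integral_multc)
  also have "\<dots> = (\<Prod>k<?m. \<integral>\<^sup>+x. F k x \<partial>\<mu> k) * (\<Prod>k<?m. \<integral>\<^sup>+x. G k x \<partial>\<nu> k)"
    by (simp add: P.product_nn_integral_prod Q.product_nn_integral_prod)
  finally show ?thesis by (simp add: \<mu>_def \<nu>_def)
qed

abbreviation pr :: "history \<Rightarrow> real" where
  "pr h \<equiv> likelihood M (hist M (length h)) h (true_params M)"

lemma
  assumes pr: "0 < pr h" and k: "k < num_businesses M"
  shows bern_lik_fit_pos: "0 < bern_lik (fit_prob M k) (outcomes (obs_fit k) h)"
    and bern_lik_quality_pos: "0 < bern_lik (quality M k) (outcomes (obs_quality k) h)"
proof -
  obtain C where C: "0 \<le> C" "\<And>\<theta>. likelihood M (hist M (length h)) h \<theta> = C *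
    (\<Prod>k<num_businesses M. bern_lik (fst \<theta> k) (outcomes (obs_fit k) h)) *
    (\<Prod>k<num_businesses M. bern_lik (snd \<theta> k) (outcomes (obs_quality k) h))"
    using likelihood_factorization by blast
  have "pr h \<noteq> 0" using pr by simp
  then have "(\<Prod>k<num_businesses M. bern_lik (fit_prob M k) (outcomes (obs_fit k) h)) \<noteq> 0"
    "(\<Prod>k<num_businesses M. bern_lik (quality M k) (outcomes (obs_quality k) h)) \<noteq> 0"
    unfolding C(2) true_params_def by (simp_all del: prod_zero_iff)
  then have "bern_lik (fit_prob M k) (outcomes (obs_fit k) h) \<noteq> 0"
    "bern_lik (quality M k) (outcomes (obs_quality k) h) \<noteq> 0"
    using k by auto
  then show "0 < bern_lik (fit_prob M k) (outcomes (obs_fit k) h)"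
    "0 < bern_lik (quality M k) (outcomes (obs_quality k) h)"
    by (simp_all add: less_le bern_lik_nonneg)
qed

lemma
  assumes pr: "0 < pr h" and k: "k < num_businesses M"
  shows fit_evidence_pos: "0 < (\<integral>q. bern_lik q (outcomes (obs_fit k) h) \<partial>fit_prior M k)"
    and quality_evidence_pos: "0 < (\<integral>q. bern_lik q (outcomes (obs_quality k) h) \<partial>quality_prior M k)"
  by (rule integral_bern_lik_pos[OF fit_prior(1,3)[OF k] bern_lik_fit_pos[OF pr k]]
      integral_bern_lik_pos[OF quality_prior(1,3)[OF k] bern_lik_quality_pos[OF pr k]])+

text \<open>Each Bernoulli likelihood is its normalized density times its evidence. The normalized
  product integrates to 1 under the independent prior, so the total evidence is the constant
  \<open>D\<close> left over, positive because \<open>pr h\<close> is.\<close>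

lemma posterior_eq_density_prod:
  assumes pr: "0 < pr h"
  defines "f \<equiv> \<lambda>k. bayes_density (fit_prior M k) (outcomes (obs_fit k) h)"
    and "g \<equiv> \<lambda>k. bayes_density (quality_prior M k) (outcomes (obs_quality k) h)"
  shows "posterior M (hist M (length h)) h = density (prior M)
    (\<lambda>\<theta>. (\<Prod>k<num_businesses M. ennreal (f k (fst \<theta> k))) * (\<Prod>k<num_businesses M. ennreal (g k (snd \<theta> k))))"
proof -
  let ?m = "num_businesses M"
  let ?Zf = "\<lambda>k. \<integral>q. bern_lik q (outcomes (obs_fit k) h) \<partial>fit_prior M k"
  let ?Zg = "\<lambda>k. \<integral>q. bern_lik q (outcomes (obs_quality k) h) \<partial>quality_prior M k"
  note Zpos = fit_evidence_pos[OF pr] quality_evidence_pos[OF pr]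
  obtain C where C: "0 \<le> C" "\<And>\<theta>. likelihood M (hist M (length h)) h \<theta> = C *
    (\<Prod>k<?m. bern_lik (fst \<theta> k) (outcomes (obs_fit k) h)) *
    (\<Prod>k<?m. bern_lik (snd \<theta> k) (outcomes (obs_quality k) h))"
    using likelihood_factorization by blast
  then have "C \<noteq> 0" using pr by auto
  define D where "D = C * (\<Prod>k<?m. ?Zf k) * (\<Prod>k<?m. ?Zg k)"
  have D: "0 < D" using C(1) \<open>C \<noteq> 0\<close> Zpos by (auto simp: D_def intro!: mult_pos_pos prod_pos)
  have fg: "0 \<le> f k x" "0 \<le> g k x" if "k < ?m" for k x
    using Zpos[OF that] by (auto simp: f_def g_def bayes_density_def bern_lik_nonneg)
  have lik: "likelihood M (hist M (length h)) h \<theta> =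
      D * ((\<Prod>k<?m. f k (fst \<theta> k)) * (\<Prod>k<?m. g k (snd \<theta> k)))" for \<theta>
  proof -
    have ff: "(\<Prod>k<?m. bern_lik (fst \<theta> k) (outcomes (obs_fit k) h)) = (\<Prod>k<?m. f k (fst \<theta> k)) * (\<Prod>k<?m. ?Zf k)"
      unfolding prod.distrib[symmetric] using Zpos(1)
      by (intro prod.cong) (auto simp: f_def bayes_density_def less_le)
    have gg: "(\<Prod>k<?m. bern_lik (snd \<theta> k) (outcomes (obs_quality k) h)) = (\<Prod>k<?m. g k (snd \<theta> k)) * (\<Prod>k<?m. ?Zg k)"
      unfolding prod.distrib[symmetric] using Zpos(2)
      by (intro prod.cong) (auto simp: g_def bayes_density_def less_le)
    show ?thesis unfolding C(2) ff gg D_def by (simp only: mult_ac)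
  qed
  have fg_prod: "ennreal ((\<Prod>k<?m. f k (fst \<theta> k)) * (\<Prod>k<?m. g k (snd \<theta> k))) =
      (\<Prod>k<?m. ennreal (f k (fst \<theta> k))) * (\<Prod>k<?m. ennreal (g k (snd \<theta> k)))" for \<theta>
  proof -
    have f: "(\<Prod>k<?m. ennreal (f k (fst \<theta> k))) = ennreal (\<Prod>k<?m. f k (fst \<theta> k))"
      by (rule prod_ennreal) (simp add: fg)
    have g: "(\<Prod>k<?m. ennreal (g k (snd \<theta> k))) = ennreal (\<Prod>k<?m. g k (snd \<theta> k))"
      by (rule prod_ennreal) (simp add: fg)
    show ?thesis unfolding f g by (rule ennreal_mult') (auto intro!: prod_nonneg simp: fg)
  qed
  have [measurable]: "f k \<in> borel_measurable borel" "g k \<in> borel_measurable borel" for k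
    by (simp_all add: f_def g_def)
  have "(\<integral>\<^sup>+\<theta>. ennreal ((\<Prod>k<?m. f k (fst \<theta> k)) * (\<Prod>k<?m. g k (snd \<theta> k))) \<partial>prior M) =
     (\<Prod>k<?m. \<integral>\<^sup>+x. f k x \<partial>fit_prior M k) * (\<Prod>k<?m. \<integral>\<^sup>+x. g k x \<partial>quality_prior M k)"
    unfolding fg_prod by (rule nn_integral_prior_prod) measurable
  also have "\<dots> = 1"
    unfolding f_def g_def
    by (simp add: nn_integral_bayes_density fit_prior(1) quality_prior(1) Zpos)
  finally have "(\<integral>\<theta>. (\<Prod>k<?m. f k (fst \<theta> k)) * (\<Prod>k<?m. g k (snd \<theta> k)) \<partial>prior M) = 1"
    using fg by (subst integral_eq_nn_integral)
      (auto intro!: borel_measurable_times borel_measurable_prod AE_I2 mult_nonneg_nonneg prod_nonneg)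
  then have evidence: "(\<integral>\<theta>. likelihood M (hist M (length h)) h \<theta> \<partial>prior M) = D"
    by (simp add: lik)
  show ?thesis
    unfolding posterior_def fg_prod[symmetric] evidence using D by (simp add: lik)
qed

lemma
  assumes pr: "0 < pr h" and j: "j < num_businesses M"
  shows fit_marginal_posterior:
      "fit_marginal (posterior M (hist M (length h)) h) j = bayes (fit_prior M j) (outcomes (obs_fit j) h)"
    and quality_marginal_posterior:
      "quality_marginal (posterior M (hist M (length h)) h) j = bayes (quality_prior M j) (outcomes (obs_quality j) h)"
proof -
  let ?m = "num_businesses M"
  define f where "f = (\<lambda>k. bayes_density (fit_prior M k) (outcomes (obs_fit k) h))"
  define g where "g = (\<lambda>k. bayes_density (quality_prior M k) (outcomes (obs_quality k) h))"
  have post: "posterior M (hist M (length h)) h = density (prior M)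
    (\<lambda>\<theta>. (\<Prod>k<?m. ennreal (f k (fst \<theta> k))) * (\<Prod>k<?m. ennreal (g k (snd \<theta> k))))"
    unfolding f_def g_def by (rule posterior_eq_density_prod[OF pr])
  have [measurable]: "f k \<in> borel_measurable borel" "g k \<in> borel_measurable borel" for k
    by (simp_all add: f_def g_def)
  note [measurable] = measurable_prior[OF j]
  have dens [measurable]: "(\<lambda>\<theta>. (\<Prod>k<?m. ennreal (f k (fst \<theta> k))) * (\<Prod>k<?m. ennreal (g k (snd \<theta> k)))) \<in> borel_measurable (prior M)"
    by (auto intro!: borel_measurable_times borel_measurable_prod)
  have one: "(\<integral>\<^sup>+x. f k x \<partial>fit_prior M k) = 1" "(\<integral>\<^sup>+x. g k x \<partial>quality_prior M k) = 1" if "k < ?m" for k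
    using that unfolding f_def g_def
    by (simp_all add: nn_integral_bayes_density fit_prior(1) quality_prior(1) fit_evidence_pos[OF pr] quality_evidence_pos[OF pr])
  interpret F: real_distribution "fit_prior M j" by (rule fit_prior(1)[OF j])
  interpret Q: real_distribution "quality_prior M j" by (rule quality_prior(1)[OF j])
  show "fit_marginal (posterior M (hist M (length h)) h) j = bayes (fit_prior M j) (outcomes (obs_fit j) h)"
  proof (rule measure_eqI)
    fix A assume "A \<in> sets (fit_marginal (posterior M (hist M (length h)) h) j)"
    then have A [measurable]: "A \<in> sets borel" by (simp add: fit_marginal_def)
    \<comment> \<open>The indicator is absorbed into the factor of business \<open>j\<close>, which
      keeps the integrand a product; all other factors integrate to 1.\<close>
    let ?F = "\<lambda>k x. ennreal (f k x) * (if k = j then indicator A x else 1)"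
    have "emeasure (fit_marginal (posterior M (hist M (length h)) h) j) A =
      (\<integral>\<^sup>+\<theta>. (\<Prod>k<?m. ennreal (f k (fst \<theta> k))) * (\<Prod>k<?m. ennreal (g k (snd \<theta> k))) * indicator A (fst \<theta> j) \<partial>prior M)"
      unfolding fit_marginal_def post
      by (simp add: emeasure_distr emeasure_density) (auto intro!: nn_integral_cong simp: indicator_def)
    also have "\<dots> = (\<integral>\<^sup>+\<theta>. (\<Prod>k<?m. ?F k (fst \<theta> k)) * (\<Prod>k<?m. ennreal (g k (snd \<theta> k))) \<partial>prior M)"
      using j by (simp add: prod.distrib prod.delta mult_ac cong: if_cong)
    also have "\<dots> = (\<Prod>k<?m. \<integral>\<^sup>+x. ?F k x \<partial>fit_prior M k) * (\<Prod>k<?m. \<integral>\<^sup>+x. g k x \<partial>quality_prior M k)"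
      by (rule nn_integral_prior_prod) measurable
    also have "(\<Prod>k<?m. \<integral>\<^sup>+x. ?F k x \<partial>fit_prior M k) =
        (\<Prod>k<?m. if k = j then \<integral>\<^sup>+x. ennreal (f j x) * indicator A x \<partial>fit_prior M j else 1)"
      by (rule prod.cong) (auto simp: one(1))
    also have "(\<Prod>k<?m. \<integral>\<^sup>+x. g k x \<partial>quality_prior M k) = 1"
      by (simp add: one(2))
    also have "(\<Prod>k<?m. if k = j then \<integral>\<^sup>+x. ennreal (f j x) * indicator A x \<partial>fit_prior M j else 1) * 1 =
        emeasure (bayes (fit_prior M j) (outcomes (obs_fit j) h)) A"
      using j by (simp add: bayes_def emeasure_density f_def prod.delta)
    finally show "emeasure (fit_marginal (posterior M (hist M (length h)) h) j) A =
      emeasure (bayes (fit_prior M j) (outcomes (obs_fit j) h)) A" .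
  qed (simp add: fit_marginal_def bayes_def)
  show "quality_marginal (posterior M (hist M (length h)) h) j = bayes (quality_prior M j) (outcomes (obs_quality j) h)"
  proof (rule measure_eqI)
    fix A assume "A \<in> sets (quality_marginal (posterior M (hist M (length h)) h) j)"
    then have A [measurable]: "A \<in> sets borel" by (simp add: quality_marginal_def)
    let ?G = "\<lambda>k x. ennreal (g k x) * (if k = j then indicator A x else 1)"
    have "emeasure (quality_marginal (posterior M (hist M (length h)) h) j) A =
      (\<integral>\<^sup>+\<theta>. (\<Prod>k<?m. ennreal (f k (fst \<theta> k))) * (\<Prod>k<?m. ennreal (g k (snd \<theta> k))) * indicator A (snd \<theta> j) \<partial>prior M)"
      unfolding quality_marginal_def post
      by (simp add: emeasure_distr emeasure_density) (auto intro!: nn_integral_cong simp: indicator_def)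
    also have "\<dots> = (\<integral>\<^sup>+\<theta>. (\<Prod>k<?m. ennreal (f k (fst \<theta> k))) * (\<Prod>k<?m. ?G k (snd \<theta> k)) \<partial>prior M)"
      using j by (simp add: prod.distrib prod.delta mult_ac cong: if_cong)
    also have "\<dots> = (\<Prod>k<?m. \<integral>\<^sup>+x. f k x \<partial>fit_prior M k) * (\<Prod>k<?m. \<integral>\<^sup>+x. ?G k x \<partial>quality_prior M k)"
      by (rule nn_integral_prior_prod) measurable
    also have "(\<Prod>k<?m. \<integral>\<^sup>+x. ?G k x \<partial>quality_prior M k) =
        (\<Prod>k<?m. if k = j then \<integral>\<^sup>+x. ennreal (g j x) * indicator A x \<partial>quality_prior M j else 1)"
      by (rule prod.cong) (auto simp: one(2))
    also have "(\<Prod>k<?m. \<integral>\<^sup>+x. f k x \<partial>fit_prior M k) = 1"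
      by (simp add: one(1))
    also have "1 * (\<Prod>k<?m. if k = j then \<integral>\<^sup>+x. ennreal (g j x) * indicator A x \<partial>quality_prior M j else 1) =
        emeasure (bayes (quality_prior M j) (outcomes (obs_quality j) h)) A"
      using j by (simp add: bayes_def emeasure_density g_def prod.delta)
    finally show "emeasure (quality_marginal (posterior M (hist M (length h)) h) j) A =
      emeasure (bayes (quality_prior M j) (outcomes (obs_quality j) h)) A" .
  qed (simp add: quality_marginal_def bayes_def)
qed

subsection \<open>Supermartingales along the history\<close>

abbreviation P where "P \<equiv> sample_space M (true_params M)"
abbreviation R where "R \<equiv> records (num_businesses M)"
abbreviation tstep where "tstep \<equiv> step M (true_params M)"

lemma prob_space_sample_space: "prob_space (sample_space M \<theta>)"
  unfolding sample_space_def by (intro prob_space_PiM prob_space_shock_dist)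

lemma
  shows hist_event_sets: "{\<omega> \<in> space P. Q (hist M n \<omega>)} \<in> sets P"
    and measure_hist_event: "measure P {\<omega> \<in> space P. Q (hist M n \<omega>)} =
      (\<Sum>h | set h \<subseteq> R \<and> length h = n \<and> Q h. pr h)"
proof -
  interpret prob_space P by (rule prob_space_sample_space)
  let ?L = "{h. set h \<subseteq> R \<and> length h = n \<and> Q h}"
  have fin: "finite ?L"
    by (rule finite_subset[OF _ finite_lists_length_eq[OF finite_records, of "num_businesses M" n]]) auto
  have eq: "{\<omega> \<in> space P. Q (hist M n \<omega>)} = (\<Union>h\<in>?L. {\<omega> \<in> space P. hist M (length h) \<omega> = h})"
    using set_hist by (auto simp: length_hist)
  show "{\<omega> \<in> space P. Q (hist M n \<omega>)} \<in> sets P"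
    unfolding eq by (intro sets.finite_UN fin hist_eq_sets)
  have "measure P {\<omega> \<in> space P. Q (hist M n \<omega>)} = (\<Sum>h\<in>?L. measure P {\<omega> \<in> space P. hist M (length h) \<omega> = h})"
    unfolding eq
    by (rule finite_measure_finite_Union[OF fin])
      (auto simp: disjoint_family_on_def intro: hist_eq_sets)
  then show "measure P {\<omega> \<in> space P. Q (hist M n \<omega>)} = (\<Sum>h\<in>?L. pr h)"
    by (simp add: likelihood_def)
qed

text \<open>There are finitely many histories of each length, so those of probability 0 are jointly
  null. Almost surely the null-measure branch of \<open>posterior\<close> is thus never met.\<close>

lemma AE_pr_pos: "AE \<omega> in P. \<forall>n. 0 < pr (hist M n \<omega>)"
proof -
  interpret prob_space P by (rule prob_space_sample_space)
  have "AE \<omega> in P. 0 < pr (hist M n \<omega>)" for n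
  proof (rule AE_I)
    show "{\<omega> \<in> space P. \<not> 0 < pr (hist M n \<omega>)} \<subseteq> {\<omega> \<in> space P. pr (hist M n \<omega>) = 0}"
      by (auto simp: likelihood_nonneg order.strict_iff_order)
    have "measure P {\<omega> \<in> space P. pr (hist M n \<omega>) = 0} = (\<Sum>h | set h \<subseteq> R \<and> length h = n \<and> pr h = 0. pr h)"
      by (rule measure_hist_event)
    also have "\<dots> = 0" by (rule sum.neutral) auto
    finally show "emeasure P {\<omega> \<in> space P. pr (hist M n \<omega>) = 0} = 0"
      by (simp only: emeasure_eq_measure ennreal_0)
    show "{\<omega> \<in> space P. pr (hist M n \<omega>) = 0} \<in> sets P"
      by (rule hist_event_sets)
  qed
  then show ?thesis by (simp add: AE_all_countable)
qed

text \<open>The sum is the expectation of \<open>Z\<close> after \<open>n\<close> rounds under the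
  true parameters. Histories of probability 0 contribute nothing, so the one-step inequality is
  asked only at the others, where the beliefs are known Bayes posteriors.\<close>

lemma supermartingale_sum_le:
  fixes Z :: "history \<Rightarrow> real"
  assumes super: "\<And>h. set h \<subseteq> R \<Longrightarrow> 0 < pr h \<Longrightarrow> (\<Sum>r\<in>R. tstep h r * Z (h @ [r])) \<le> Z h"
  shows "(\<Sum>h | set h \<subseteq> R \<and> length h = n. pr h * Z h) \<le> Z []"
proof (induction n)
  case 0
  have "{h. set h \<subseteq> R \<and> length h = 0} = {[]}" by auto
  then show ?case by (simp add: likelihood_Nil del: hist.simps)
next
  case (Suc n)
  let ?L = "\<lambda>n. {h. set h \<subseteq> R \<and> length h = n}"
  have L: "?L (Suc n) = (\<lambda>(h, r). h @ [r]) ` (?L n \<times> R)"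
  proof (intro equalityI subsetI)
    fix h assume "h \<in> ?L (Suc n)"
    then show "h \<in> (\<lambda>(h, r). h @ [r]) ` (?L n \<times> R)"
      by (cases h rule: rev_cases) (auto simp: image_iff)
  qed auto
  have "(\<Sum>h\<in>?L (Suc n). pr h * Z h) = (\<Sum>(h, r)\<in>?L n \<times> R. pr (h @ [r]) * Z (h @ [r]))"
    unfolding L by (subst sum.reindex) (auto simp: inj_on_def intro!: sum.cong)
  also have "\<dots> = (\<Sum>h\<in>?L n. \<Sum>r\<in>R. pr (h @ [r]) * Z (h @ [r]))"
    by (rule sum.cartesian_product[symmetric])
  also have "\<dots> = (\<Sum>h\<in>?L n. pr h * (\<Sum>r\<in>R. tstep h r * Z (h @ [r])))"
  proof -
    have "pr (h @ [r]) = pr h * tstep h r" for h r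
      using likelihood_snoc[of h r "true_params M"] by (simp del: hist.simps)
    then show ?thesis by (simp only: sum_distrib_left mult_ac)
  qed
  also have "\<dots> \<le> (\<Sum>h\<in>?L n. pr h * Z h)"
  proof (rule sum_mono)
    fix h assume "h \<in> ?L n"
    then show "pr h * (\<Sum>r\<in>R. tstep h r * Z (h @ [r])) \<le> pr h * Z h"
      using super[of h] likelihood_nonneg[of "hist M (length h)" h "true_params M"]
      by (cases "pr h = 0") (auto simp: less_le intro!: mult_left_mono)
  qed
  finally show ?case using Suc.IH by simp
qed

text \<open>Markov's inequality for \<open>Z\<close> at a fixed round.\<close>

lemma supermartingale_maximal:
  fixes Z :: "history \<Rightarrow> real"
  assumes super: "\<And>h. set h \<subseteq> R \<Longrightarrow> 0 < pr h \<Longrightarrow> (\<Sum>r\<in>R. tstep h r * Z (h @ [r])) \<le> Z h"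
    and Z: "\<And>h. 0 \<le> Z h" and c: "0 < c" "\<And>h. length h = n \<Longrightarrow> Q h \<Longrightarrow> c \<le> Z h"
  shows "measure P {\<omega> \<in> space P. Q (hist M n \<omega>)} \<le> Z [] / c"
proof -
  have fin: "finite {h. set h \<subseteq> R \<and> length h = n}"
    by (rule finite_lists_length_eq[OF finite_records])
  have "c * measure P {\<omega> \<in> space P. Q (hist M n \<omega>)} = (\<Sum>h | set h \<subseteq> R \<and> length h = n \<and> Q h. pr h * c)"
    by (simp add: measure_hist_event sum_distrib_left mult_ac)
  also have "\<dots> \<le> (\<Sum>h | set h \<subseteq> R \<and> length h = n \<and> Q h. pr h * Z h)"
    by (intro sum_mono mult_left_mono c likelihood_nonneg) auto
  also have "\<dots> \<le> (\<Sum>h | set h \<subseteq> R \<and> length h = n. pr h * Z h)"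
    by (intro sum_mono2 fin) (auto intro!: mult_nonneg_nonneg Z likelihood_nonneg)
  also have "\<dots> \<le> Z []" by (rule supermartingale_sum_le[OF super])
  finally show ?thesis using c(1) by (simp add: field_simps)
qed

text \<open>
  The observations selected by \<open>ob\<close> behave like Bernoulli trials with parameter \<open>x\<close>, in the only
  form needed: passing from \<open>x\<close> to any \<open>y\<close> turns the round probabilities into those of another
  parameter, so that they still sum to 1.
\<close>

definition selects_bernoulli :: "(round_record \<Rightarrow> bool option) \<Rightarrow> real \<Rightarrow> bool" where
  "selects_bernoulli ob x \<longleftrightarrow> (\<forall>y\<in>{0<..<1}. \<forall>h. (\<Sum>r\<in>R. tstep h r * (weight y (ob r) / weight x (ob r))) = 1)"

lemma selects_bernoulli_fit:
  assumes j: "j < num_businesses M"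
  shows "selects_bernoulli (obs_fit j) (fit_prob M j)"
  unfolding selects_bernoulli_def
proof (intro ballI allI)
  fix y :: real and h assume "y \<in> {0<..<1}"
  let ?\<theta> = "((fit_prob M)(j := y), quality M)"
  have nz: "weight (fit_prob M j) ob \<noteq> 0" for ob
    using fit_prob_bounds[OF j] by (cases ob; cases "the ob") auto
  have "tstep h r * (weight y (obs_fit j r) / weight (fit_prob M j) (obs_fit j r)) = step M ?\<theta> h r" for r
  proof -
    have "(\<Prod>k<num_businesses M. weight (((fit_prob M)(j := y)) k) (obs_fit k r)) * weight (fit_prob M j) (obs_fit j r) =
      (\<Prod>k<num_businesses M. weight (fit_prob M k) (obs_fit k r)) * weight y (obs_fit j r)"
      using j by (simp add: prod.remove[of "{..<num_businesses M}" j])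
    then show ?thesis
      using nz by (simp add: step_def measure_round_outcome true_params_def field_simps)
  qed
  then show "(\<Sum>r\<in>R. tstep h r * (weight y (obs_fit j r) / weight (fit_prob M j) (obs_fit j r))) = 1"
    using sum_step by simp
qed

text \<open>Interior quality keeps the denominators nonzero. Qualities 0 and 1 give constant
  observations and are treated directly in the main proof.\<close>

lemma selects_bernoulli_quality:
  assumes j: "j < num_businesses M" and Q: "quality M j \<in> {0<..<1}"
  shows "selects_bernoulli (obs_quality j) (quality M j)"
  unfolding selects_bernoulli_def
proof (intro ballI allI)
  fix y :: real and h assume "y \<in> {0<..<1}"
  let ?\<theta> = "(fit_prob M, (quality M)(j := y))"
  have nz: "weight (quality M j) ob \<noteq> 0" for ob
    using Q by (cases ob; cases "the ob") auto
  have "tstep h r * (weight y (obs_quality j r) / weight (quality M j) (obs_quality j r)) = step M ?\<theta> h r" for r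
  proof -
    have "(\<Prod>k<num_businesses M. weight (((quality M)(j := y)) k) (obs_quality k r)) * weight (quality M j) (obs_quality j r) =
      (\<Prod>k<num_businesses M. weight (quality M k) (obs_quality k r)) * weight y (obs_quality j r)"
      using j by (simp add: prod.remove[of "{..<num_businesses M}" j])
    then show ?thesis
      using nz by (simp add: step_def measure_round_outcome true_params_def field_simps)
  qed
  then show "(\<Sum>r\<in>R. tstep h r * (weight y (obs_quality j r) / weight (quality M j) (obs_quality j r))) = 1"
    using sum_step by simp
qed

section \<open>Almost sure limits of the observed frequencies\<close>

lemma outcomes_hist_prefix:
  assumes "n \<le> n'"
  shows "\<exists>l. outcomes ob (hist M n' \<omega>) = outcomes ob (hist M n \<omega>) @ l"
  using assms by (induction rule: dec_induct) auto

text \<open>A Chernoff bound with \<open>y\<close> as the tilted parameter: if the frequency after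
  \<open>k\<close> observations lies at or beyond \<open>y\<close>, seen from \<open>x\<close>, the
  likelihood ratio is at least \<open>exp (c * k)\<close> with \<open>c\<close> the relative
  entropy. The threshold \<open>k0\<close> counts observations, not rounds.\<close>

lemma eventually_no_deviation:
  fixes x y :: real
  assumes sel: "selects_bernoulli ob x" and x: "x \<in> {0<..<1}" and y: "y \<in> {0<..<1}" and "x \<noteq> y"
  shows "AE \<omega> in P. \<exists>k0. \<forall>n. k0 \<le> length (outcomes ob (hist M n \<omega>)) \<longrightarrow>
    (y - x) * (count_list (outcomes ob (hist M n \<omega>)) True - y * length (outcomes ob (hist M n \<omega>))) < 0"
proof -
  interpret prob_space P by (rule prob_space_sample_space)
  define c where "c = y * (ln y - ln x) + (1 - y) * (ln (1 - y) - ln (1 - x))"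
  have c: "0 < c" unfolding c_def by (rule relative_entropy_pos) fact+
  define dev where "dev l \<longleftrightarrow> 0 \<le> (y - x) * (count_list l True - y * length l)" for l
  \<comment> \<open>Only the first \<open>k\<close> observations matter, so \<open>Q\<close>
    persists once it holds. Hence \<open>E k n\<close> increases in \<open>n\<close>, and its bound
    passes to the union over all rounds.\<close>
  define Q where "Q k h \<longleftrightarrow> k \<le> length (outcomes ob h) \<and> dev (take k (outcomes ob h))" for k h
  define E where "E k n = {\<omega> \<in> space P. Q k (hist M n \<omega>)}" for k n
  have E_sets: "E k n \<in> sets P" for k n
    unfolding E_def by (rule hist_event_sets)
  have E_bound: "prob (E k n) \<le> exp (- c) ^ k" for k n
  proof -
    \<comment> \<open>The likelihood ratio, frozen after the \<open>k\<close>-th observation. Before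
      that, a round multiplies it by a weight ratio of mean 1.\<close>
    define Z where "Z h = bern_lik y (take k (outcomes ob h)) / bern_lik x (take k (outcomes ob h))" for h
    have "prob (E k n) \<le> Z [] / exp (c * k)"
      unfolding E_def
    proof (rule supermartingale_maximal)
      fix h
      show "0 \<le> Z h" by (simp add: Z_def bern_lik_nonneg)
      show "exp (c * k) \<le> Z h" if "Q k h"
        using exp_le_bern_lik_ratio[OF x y, of "take k (outcomes ob h)"] that
        by (auto simp: Q_def dev_def c_def Z_def min_absorb2)
      show "(\<Sum>r\<in>R. tstep h r * Z (h @ [r])) \<le> Z h"
      proof (cases "k \<le> length (outcomes ob h)")
        case True
        then have "Z (h @ [r]) = Z h" for r by (simp add: Z_def del: outcomes_single)
        then show ?thesis by (simp add: sum_step flip: sum_distrib_right)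
      next
        case False
        have "Z (h @ [r]) = Z h * (weight y (ob r) / weight x (ob r))" for r
        proof -
          have "take k (outcomes ob (h @ [r])) = outcomes ob h @ outcomes ob [r]"
            using False by (auto split: option.splits)
          then show ?thesis
            using False by (simp add: Z_def bern_lik_append weight_outcomes_single del: outcomes_append outcomes_single)
        qed
        then have "(\<Sum>r\<in>R. tstep h r * Z (h @ [r])) = Z h * (\<Sum>r\<in>R. tstep h r * (weight y (ob r) / weight x (ob r)))"
          by (simp add: sum_distrib_left mult_ac)
        then show ?thesis using sel y by (simp add: selects_bernoulli_def)
      qed
    qed simp
    also have "\<dots> = exp (- c) ^ k"
      by (simp add: Z_def exp_minus field_simps flip: exp_of_nat_mult)
    finally show ?thesis .
  qed
  have incseq: "incseq (E k)" for k
  proof (rule incseq_SucI, rule subsetI)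
    fix n \<omega> assume "\<omega> \<in> E k n"
    then show "\<omega> \<in> E k (Suc n)" by (simp add: E_def Q_def del: outcomes_single)
  qed
  have "prob (\<Union>n. E k n) \<le> exp (- c) ^ k" for k
    using E_sets E_bound incseq by (intro LIMSEQ_le_const2[OF finite_Lim_measure_incseq]) auto
  then have "summable (\<lambda>k. prob (\<Union>n. E k n))"
    using c by (intro summable_comparison_test'[OF summable_geometric[of "exp (- c)"]]) auto
  then have "AE \<omega> in P. eventually (\<lambda>k. \<omega> \<in> space P - (\<Union>n. E k n)) sequentially"
    using E_sets by (intro borel_cantelli_AE1) (auto simp: emeasure_eq_measure)
  then show ?thesis
  proof eventually_elim
    case (elim \<omega>)
    then obtain k0 where k0: "\<And>k. k0 \<le> k \<Longrightarrow> \<omega> \<in> space P - (\<Union>n. E k n)"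
      by (auto simp: eventually_sequentially)
    show ?case
    proof (intro exI allI impI)
      fix n assume "k0 \<le> length (outcomes ob (hist M n \<omega>))"
      from k0[OF this] show "(y - x) * (count_list (outcomes ob (hist M n \<omega>)) True - y * length (outcomes ob (hist M n \<omega>))) < 0"
        by (auto simp: E_def Q_def dev_def not_le)
    qed
  qed
qed

text \<open>Countably many rational \<open>y\<close> share one almost sure event, and between
  \<open>x\<close> and any other bound lies such a \<open>y\<close>. The implication is needed since
  the business may be observed only finitely often.\<close>

lemma frequency_tendsto:
  assumes sel: "selects_bernoulli ob x" and x: "x \<in> {0<..<1}"
  shows "AE \<omega> in P. filterlim (\<lambda>n. length (outcomes ob (hist M n \<omega>))) at_top sequentially \<longrightarrow>
    (\<lambda>n. count_list (outcomes ob (hist M n \<omega>)) True / length (outcomes ob (hist M n \<omega>))) \<longlonglongrightarrow> x"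
proof -
  have "AE \<omega> in P. \<forall>y\<in>\<rat> \<inter> {0<..<1} - {x}. \<exists>k0. \<forall>n. k0 \<le> length (outcomes ob (hist M n \<omega>)) \<longrightarrow>
    (y - x) * (count_list (outcomes ob (hist M n \<omega>)) True - y * length (outcomes ob (hist M n \<omega>))) < 0"
    using eventually_no_deviation[OF sel x]
    by (subst AE_ball_countable) (auto intro: countable_subset[OF _ countable_rat])
  then show ?thesis
  proof (eventually_elim, intro impI)
    fix \<omega>
    let ?l = "\<lambda>n. outcomes ob (hist M n \<omega>)"
    assume *: "\<forall>y\<in>\<rat> \<inter> {0<..<1} - {x}. \<exists>k0. \<forall>n. k0 \<le> length (?l n) \<longrightarrow>
        (y - x) * (count_list (?l n) True - y * length (?l n)) < 0"
      and len: "filterlim (\<lambda>n. length (?l n)) at_top sequentially"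
    have ev: "eventually (\<lambda>n. 0 < length (?l n) \<and>
        (y - x) * (count_list (?l n) True / length (?l n) - y) < 0) sequentially"
      if "y \<in> \<rat>" "y \<in> {0<..<1}" "y \<noteq> x" for y
    proof -
      obtain k0 where k0: "\<And>n. k0 \<le> length (?l n) \<Longrightarrow> (y - x) * (count_list (?l n) True - y * length (?l n)) < 0"
        using * \<open>y \<in> \<rat>\<close> \<open>y \<in> {0<..<1}\<close> \<open>y \<noteq> x\<close> by blast
      have "eventually (\<lambda>n. max 1 k0 \<le> length (?l n)) sequentially"
        using len unfolding filterlim_at_top by blast
      then show ?thesis
      proof eventually_elim
        case (elim n)
        then have pos: "0 < real (length (?l n))" by linarith
        have "(y - x) * (count_list (?l n) True / length (?l n) - y) =
            (y - x) * (count_list (?l n) True - y * length (?l n)) / length (?l n)"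
          using pos by (simp add: field_simps)
        also have "\<dots> < 0" using k0[of n] elim pos by (simp add: divide_neg_pos)
        finally show ?case using pos by simp
      qed
    qed
    show "(\<lambda>n. count_list (?l n) True / length (?l n)) \<longlonglongrightarrow> x"
    proof (rule order_tendstoI)
      fix a assume "a < x"
      then have "max a 0 < x" using x by simp
      then obtain y where y: "y \<in> \<rat>" "max a 0 < y" "y < x" using Rats_dense_in_real by blast
      then have "eventually (\<lambda>n. 0 < length (?l n) \<and>
          (y - x) * (count_list (?l n) True / length (?l n) - y) < 0) sequentially"
        using x by (intro ev) auto
      then show "eventually (\<lambda>n. a < count_list (?l n) True / length (?l n)) sequentially"
        by eventually_elim (use y in \<open>auto simp: mult_less_0_iff\<close>)
    next
      fix a assume "x < a"
      then have "x < min a 1" using x by simp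
      then obtain y where y: "y \<in> \<rat>" "x < y" "y < min a 1" using Rats_dense_in_real by blast
      then have "eventually (\<lambda>n. 0 < length (?l n) \<and>
          (y - x) * (count_list (?l n) True / length (?l n) - y) < 0) sequentially"
        using x by (intro ev) auto
      then show "eventually (\<lambda>n. count_list (?l n) True / length (?l n) < a) sequentially"
        by eventually_elim (use y in \<open>auto simp: mult_less_0_iff\<close>)
    qed
  qed
qed

subsection \<open>Businesses above the inspection threshold\<close>

text \<open>Two independent events suffice: the value lies in the open set \<open>U\<close> around
  which the index stays positive, and no business fits. Then the search runs through its whole list,
  which contains \<open>j\<close>. The bound depends on the history only through the two means for
  \<open>j\<close>.\<close>

lemma inspection_prob_pos:
  assumes j: "j < num_businesses M" and pos: "0 < index M j p q (max_value M)"
  obtains \<delta> where "0 < \<delta>" "\<delta> < 1"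
    "\<And>h. mean (fit_marginal (posterior M (hist M (length h)) h) j) = p \<Longrightarrow>
      mean (quality_marginal (posterior M (hist M (length h)) h) j) = q \<Longrightarrow>
      \<delta> \<le> (\<Sum>r | r \<in> R \<and> obs_fit j r \<noteq> None. tstep h r)"
proof -
  let ?m = "num_businesses M"
  interpret V: prob_space "value_dist M" by (rule prob_space_value_dist[OF valid])
  interpret S: prob_space "shock_dist M (true_params M)" by (rule prob_space_shock_dist)
  define U where "U = {v. 0 < index M j p q v}"
  have "open U" unfolding U_def index_def by (intro open_Collect_less continuous_intros)
  then have U [simp]: "U \<in> sets borel" and "0 < emeasure (value_dist M) U"
    using max_value_in_msupport pos by (auto simp: msupport_def U_def)
  then have U_pos: "0 < measure (value_dist M) U" by (simp add: V.emeasure_eq_measure)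
  define \<epsilon> where "\<epsilon> = measure (value_dist M) U * (\<Prod>k<?m. 1 - fit_prob M k)"
  have \<epsilon>: "0 < \<epsilon>"
    unfolding \<epsilon>_def using U_pos fit_prob_bounds by (intro mult_pos_pos prod_pos) auto
  have bound: "\<epsilon> \<le> (\<Sum>r | r \<in> R \<and> obs_fit j r \<noteq> None. tstep h r)"
    if p: "mean (fit_marginal (posterior M (hist M (length h)) h) j) = p"
      and q: "mean (quality_marginal (posterior M (hist M (length h)) h) j) = q" for h
  proof -
    let ?B = "posterior M (hist M (length h)) h" and ?S = "shock_dist M (true_params M)"
    let ?A = "U \<times>
      {f \<in> space (\<Pi>\<^sub>M j\<in>{..<?m}. measure_pmf (bernoulli_pmf (fst (true_params M) j))). \<forall>k\<in>{..<?m}. f k \<in> {False}} \<times>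
      {q \<in> space (\<Pi>\<^sub>M j\<in>{..<?m}. measure_pmf (bernoulli_pmf (snd (true_params M) j))). \<forall>k\<in>{..<?m}. q k \<in> UNIV}"
    let ?E = "\<lambda>r. {s \<in> space ?S. round_outcome M ?B h s = r}"
    have unfit: "(\<Prod>k<?m. emeasure (measure_pmf (bernoulli_pmf (fit_prob M k))) {False}) = ennreal (\<Prod>k<?m. 1 - fit_prob M k)"
    proof (subst prod_ennreal[symmetric])
      show "0 \<le> 1 - fit_prob M k" if "k \<in> {..<?m}" for k using fit_prob_bounds[of k] that by auto
      show "(\<Prod>k<?m. emeasure (measure_pmf (bernoulli_pmf (fit_prob M k))) {False}) = (\<Prod>k<?m. ennreal (1 - fit_prob M k))"
        using fit_prob_bounds by (intro prod.cong) (auto simp: emeasure_pmf_single less_imp_le)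
    qed
    have "emeasure ?S ?A = ennreal \<epsilon>"
      unfolding emeasure_shock_Times[OF U]
      by (simp add: V.emeasure_eq_measure true_params_def unfit \<epsilon>_def ennreal_mult'
          measure_pmf.emeasure_space_1[simplified])
    then have "\<epsilon> = measure ?S ?A" using \<epsilon> by (simp add: measure_def)
    also have "\<dots> \<le> measure ?S (\<Union>r\<in>{r \<in> R. obs_fit j r \<noteq> None}. ?E r)"
    proof (rule S.finite_measure_mono)
      show "?A \<subseteq> (\<Union>r\<in>{r \<in> R. obs_fit j r \<noteq> None}. ?E r)"
      proof
        fix s assume s: "s \<in> ?A"
        obtain v f g where vfg: "s = (v, f, g)" by (cases s)
        have "set (search_order M ?B h v) = inspected (search_order M ?B h v) f"
          using s by (intro inspected_all_unfit[symmetric]) (auto simp: vfg set_search_order)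
        moreover have "j \<in> set (search_order M ?B h v)"
          using s j p q by (auto simp: vfg set_search_order U_def belief_index_def)
        ultimately have "obs_fit j (round_outcome M ?B h s) \<noteq> None"
          by (simp add: vfg round_outcome_def obs_search_record)
        moreover have "s \<in> space ?S"
          using s by (auto simp: vfg shock_dist_def space_pair_measure)
        ultimately show "s \<in> (\<Union>r\<in>{r \<in> R. obs_fit j r \<noteq> None}. ?E r)"
          using round_outcome_in_records by auto
      qed
      show "(\<Union>r\<in>{r \<in> R. obs_fit j r \<noteq> None}. ?E r) \<in> sets ?S"
        using finite_records by (intro sets.finite_UN round_event_sets) auto
    qed
    also have "\<dots> = (\<Sum>r | r \<in> R \<and> obs_fit j r \<noteq> None. tstep h r)"
      unfolding step_def using finite_records
      by (intro S.finite_measure_finite_Union) (auto simp: disjoint_family_on_def intro: round_event_sets)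
    finally show ?thesis .
  qed
  \<comment> \<open>The cap 1/2 ensures \<delta> < 1, so that later one may divide by 1 -
    \<delta>.\<close>
  show thesis
    by (rule that[of "min \<epsilon> (1/2)"]) (use \<epsilon> bound in \<open>force+\<close>)
qed

lemma take_hist: "i \<le> n \<Longrightarrow> take i (hist M n \<omega>) = hist M i \<omega>"
  by (induction rule: dec_induct) auto

text \<open>Fixing the two lists fixes the belief about \<open>j\<close>, so one \<delta> serves all
  rounds from \<open>n0\<close> on, while the rest of the history stays free. Remaining stuck for
  \<open>t\<close> rounds then has probability at most \<open>(1 - \<delta>) ^ t\<close>.\<close>

lemma not_stuck_above_threshold:
  assumes j: "j < num_businesses M"
    and pos: "0 < index M j (mean (bayes (fit_prior M j) lF)) (mean (bayes (quality_prior M j) lQ)) (max_value M)"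
  shows "AE \<omega> in P. \<not> (\<forall>n\<ge>n0. outcomes (obs_fit j) (hist M n \<omega>) = lF \<and> outcomes (obs_quality j) (hist M n \<omega>) = lQ)"
proof -
  interpret prob_space P by (rule prob_space_sample_space)
  define stay where "stay h \<longleftrightarrow> outcomes (obs_fit j) h = lF \<and> outcomes (obs_quality j) h = lQ" for h
  obtain \<delta> where \<delta>: "0 < \<delta>" "\<delta> < 1" and inspect: "\<And>h. mean (fit_marginal (posterior M (hist M (length h)) h) j) = mean (bayes (fit_prior M j) lF) \<Longrightarrow>
      mean (quality_marginal (posterior M (hist M (length h)) h) j) = mean (bayes (quality_prior M j) lQ) \<Longrightarrow>
      \<delta> \<le> (\<Sum>r | r \<in> R \<and> obs_fit j r \<noteq> None. tstep h r)"
    using inspection_prob_pos[OF j pos] by blast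
  \<comment> \<open>Any inspection of \<open>j\<close> lengthens its list of fits, so staying put
    requires a round without one.\<close>
  have step_le: "(\<Sum>r | r \<in> R \<and> stay (h @ [r]). tstep h r) \<le> 1 - \<delta>" if "0 < pr h" "stay h" for h
  proof -
    have "(\<Sum>r | r \<in> R \<and> stay (h @ [r]). tstep h r) \<le> (\<Sum>r | r \<in> R \<and> obs_fit j r = None. tstep h r)"
      using that finite_records
      by (intro sum_mono2) (auto simp: stay_def step_nonneg split: option.splits)
    moreover have "(\<Sum>r\<in>R. tstep h r) = (\<Sum>r | r \<in> R \<and> obs_fit j r = None. tstep h r) + (\<Sum>r | r \<in> R \<and> obs_fit j r \<noteq> None. tstep h r)"
      using finite_records by (subst sum.union_disjoint[symmetric]) (auto intro!: sum.cong)
    moreover have "\<delta> \<le> (\<Sum>r | r \<in> R \<and> obs_fit j r \<noteq> None. tstep h r)"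
      using that by (intro inspect) (auto simp: fit_marginal_posterior[OF that(1) j] quality_marginal_posterior[OF that(1) j] stay_def)
    ultimately show ?thesis by (simp add: sum_step)
  qed
  define Q where "Q h \<longleftrightarrow> (\<forall>i. n0 \<le> i \<and> i \<le> length h \<longrightarrow> stay (take i h))" for h
  have Q_snoc: "Q (h @ [r]) \<longleftrightarrow> Q h \<and> stay (h @ [r])" if "n0 \<le> length h" for h r
    unfolding Q_def length_append_singleton le_Suc_eq using that
    by (auto simp: all_conj_distrib conj_disj_distribL imp_disjL)
  have bound: "prob {\<omega> \<in> space P. Q (hist M (n0 + t) \<omega>)} \<le> (1 - \<delta>) ^ t" for t
  proof -
    \<comment> \<open>Constant 1 up to round \<open>n0\<close>, then growing by
      \<open>1 / (1 - \<delta>)\<close> per round survived and 0 after a change. At length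
      \<open>n0\<close> it is 1 even if \<open>Q\<close> fails, which a supermartingale
      tolerates.\<close>
    define Z where "Z h = (if length h \<le> n0 then 1 else if Q h then (1 / (1 - \<delta>)) ^ (length h - n0) else 0)" for h
    have "prob {\<omega> \<in> space P. Q (hist M (n0 + t) \<omega>)} \<le> Z [] / (1 / (1 - \<delta>)) ^ t"
    proof (rule supermartingale_maximal)
      fix h
      show "0 \<le> Z h" using \<delta> by (simp add: Z_def)
      show "(1 / (1 - \<delta>)) ^ t \<le> Z h" if "length h = n0 + t" "Q h"
        using that by (auto simp: Z_def)
      show "(\<Sum>r\<in>R. tstep h r * Z (h @ [r])) \<le> Z h" if "0 < pr h"
      proof (cases "length h < n0")
        case True
        then show ?thesis by (simp add: Z_def sum_step)
      next
        case False
        let ?c = "(1 / (1 - \<delta>)) ^ (length h - n0)"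
        have Z_snoc: "tstep h r * Z (h @ [r]) = (if Q h \<and> stay (h @ [r]) then tstep h r * ?c / (1 - \<delta>) else 0)" for r
          using False by (simp add: Z_def Q_snoc Suc_diff_le)
        show ?thesis
        proof (cases "Q h")
          case True
          then have "stay h" using False by (auto simp: Q_def dest: spec[of _ "length h"])
          have "(\<Sum>r\<in>R. tstep h r * Z (h @ [r])) = (\<Sum>r | r \<in> R \<and> stay (h @ [r]). tstep h r) * ?c / (1 - \<delta>)"
            using True finite_records
            unfolding Z_snoc sum.inter_filter[OF finite_records] sum_distrib_right sum_divide_distrib
            by (intro sum.cong) auto
          also have "\<dots> \<le> (1 - \<delta>) * ?c / (1 - \<delta>)"
            using \<delta> step_le[OF \<open>0 < pr h\<close> \<open>stay h\<close>] by (intro divide_right_mono mult_right_mono) auto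
          also have "\<dots> = Z h" using True False \<delta> by (auto simp: Z_def)
          finally show ?thesis .
        next
          case False
          then show ?thesis using \<open>\<not> length h < n0\<close> \<delta> by (simp add: Z_snoc) (simp add: Z_def)
        qed
      qed
    qed (use \<delta> in simp)
    also have "\<dots> = (1 - \<delta>) ^ t" by (simp add: Z_def power_divide)
    finally show ?thesis .
  qed
  show ?thesis
  proof (rule AE_I)
    let ?N = "\<Inter>t. {\<omega> \<in> space P. Q (hist M (n0 + t) \<omega>)}"
    show "{\<omega> \<in> space P. \<not> \<not> (\<forall>n\<ge>n0. outcomes (obs_fit j) (hist M n \<omega>) = lF \<and> outcomes (obs_quality j) (hist M n \<omega>) = lQ)} \<subseteq> ?N"
      by (auto simp: Q_def stay_def take_hist)
    show N: "?N \<in> sets P" by (intro sets.countable_INT) (auto intro: hist_event_sets)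
    have "prob ?N \<le> (1 - \<delta>) ^ t" for t
      by (rule order_trans[OF finite_measure_mono bound[of t]]) (auto intro: hist_event_sets)
    then have "prob ?N \<le> 0"
      using \<delta> by (intro LIMSEQ_le_const[OF LIMSEQ_power_zero[of "1 - \<delta>"]]) auto
    then show "emeasure P ?N = 0" by (simp add: emeasure_eq_measure measure_le_0_iff)
  qed
qed

lemma length_outcomes_quality:
  "length (outcomes (obs_quality j) (hist M n \<omega>)) = count_list (outcomes (obs_fit j) (hist M n \<omega>)) True"
proof (induction n)
  case (Suc n)
  show ?case
    by (auto simp: Suc.IH round_outcome_def obs_search_record split: prod.split)
qed simp

end

theorem proposition5p1:
  fixes M :: market and j :: nat
  assumes "valid_market M" and "j < num_businesses M"
  shows "AE \<omega> in sample_space M (true_params M).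
    (\<exists>F_lim Q_lim. real_distribution F_lim \<and> real_distribution Q_lim \<and>
       weak_conv_m (fit_belief M j \<omega>) F_lim \<and>
       weak_conv_m (quality_belief M j \<omega>) Q_lim) \<and>
    ((learned M j \<omega> \<and>
      weak_conv_m (fit_belief M j \<omega>) (return borel (fit_prob M j)) \<and>
      weak_conv_m (quality_belief M j \<omega>) (return borel (quality M j))) \<or>
     lost M j \<omega>)"
proof -
  interpret market_model M by unfold_locales fact
  note j = \<open>j < num_businesses M\<close>
  let ?x = "fit_prob M j" and ?q = "quality M j"
  let ?I = "\<lambda>lF lQ. index M j (mean (bayes (fit_prior M j) lF)) (mean (bayes (quality_prior M j) lQ)) (max_value M)"
  \<comment> \<open>Rounds and Boolean lists form countable types, so the exceptional null sets may
    be united; the statement can then be used with the random final lists of \<omega>.\<close>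
  have "AE \<omega> in P. \<forall>n0 lF lQ. 0 < ?I lF lQ \<longrightarrow>
    \<not> (\<forall>n\<ge>n0. outcomes (obs_fit j) (hist M n \<omega>) = lF \<and> outcomes (obs_quality j) (hist M n \<omega>) = lQ)"
    unfolding AE_all_countable using not_stuck_above_threshold[OF j] by auto
  moreover have "AE \<omega> in P. ?q \<in> {0<..<1} \<longrightarrow> filterlim (\<lambda>n. length (outcomes (obs_quality j) (hist M n \<omega>))) at_top sequentially \<longrightarrow>
    (\<lambda>n. count_list (outcomes (obs_quality j) (hist M n \<omega>)) True / length (outcomes (obs_quality j) (hist M n \<omega>))) \<longlonglongrightarrow> ?q"
    using frequency_tendsto[OF selects_bernoulli_quality[OF j]] by (cases "?q \<in> {0<..<1}") simp_all
  moreover note frequency_tendsto[OF selects_bernoulli_fit[OF j] fit_prob_bounds[OF j]] AE_pr_pos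
  ultimately show ?thesis
  proof eventually_elim
    fix \<omega>
    define lF where "lF n = outcomes (obs_fit j) (hist M n \<omega>)" for n
    define lQ where "lQ n = outcomes (obs_quality j) (hist M n \<omega>)" for n
    assume "\<forall>n0 lF lQ. 0 < ?I lF lQ \<longrightarrow>
        \<not> (\<forall>n\<ge>n0. outcomes (obs_fit j) (hist M n \<omega>) = lF \<and> outcomes (obs_quality j) (hist M n \<omega>) = lQ)"
      and "?q \<in> {0<..<1} \<longrightarrow> filterlim (\<lambda>n. length (outcomes (obs_quality j) (hist M n \<omega>))) at_top sequentially \<longrightarrow>
        (\<lambda>n. count_list (outcomes (obs_quality j) (hist M n \<omega>)) True / length (outcomes (obs_quality j) (hist M n \<omega>))) \<longlonglongrightarrow> ?q"
      and "filterlim (\<lambda>n. length (outcomes (obs_fit j) (hist M n \<omega>))) at_top sequentially \<longrightarrow>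
        (\<lambda>n. count_list (outcomes (obs_fit j) (hist M n \<omega>)) True / length (outcomes (obs_fit j) (hist M n \<omega>))) \<longlonglongrightarrow> ?x"
      and "\<forall>n. 0 < pr (hist M n \<omega>)"
    then have not_stuck: "\<And>n0 a b. 0 < ?I a b \<Longrightarrow> \<not> (\<forall>n\<ge>n0. lF n = a \<and> lQ n = b)"
      and freqQ: "?q \<in> {0<..<1} \<Longrightarrow> filterlim (\<lambda>n. length (lQ n)) at_top sequentially \<Longrightarrow>
        (\<lambda>n. count_list (lQ n) True / length (lQ n)) \<longlonglongrightarrow> ?q"
      and freqF: "filterlim (\<lambda>n. length (lF n)) at_top sequentially \<Longrightarrow>
        (\<lambda>n. count_list (lF n) True / length (lF n)) \<longlonglongrightarrow> ?x"
      and pr: "\<And>n. 0 < pr (hist M n \<omega>)"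
      unfolding lF_def lQ_def by blast+
    have lenQ: "length (lQ n) = count_list (lF n) True" for n
      unfolding lF_def lQ_def by (rule length_outcomes_quality)
    have posF: "0 < bern_lik ?x (lF n)" and posQ: "0 < bern_lik ?q (lQ n)" for n
      unfolding lF_def lQ_def by (rule bern_lik_fit_pos bern_lik_quality_pos; rule pr j)+
    have fitB: "fit_belief M j \<omega> = (\<lambda>n. bayes (fit_prior M j) (lF n))"
      unfolding fit_belief_def belief_def lF_def
      using fit_marginal_posterior[OF pr j] by (auto simp del: hist.simps)
    have qualityB: "quality_belief M j \<omega> = (\<lambda>n. bayes (quality_prior M j) (lQ n))"
      unfolding quality_belief_def belief_def lQ_def
      using quality_marginal_posterior[OF pr j] by (auto simp del: hist.simps)
    have rdF: "real_distribution (bayes (fit_prior M j) (lF n))" for n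
      by (intro real_distribution_bayes integral_bern_lik_pos[OF _ _ posF] fit_prior[OF j])
    have rdQ: "real_distribution (bayes (quality_prior M j) (lQ n))" for n
      by (intro real_distribution_bayes integral_bern_lik_pos[OF _ _ posQ] quality_prior[OF j])
    have prefix: "\<exists>l. lF n' = lF n @ l" "\<exists>l. lQ n' = lQ n @ l" if "n \<le> n'" for n n'
      using outcomes_hist_prefix[OF that] unfolding lF_def lQ_def by auto
    have mono: "mono (\<lambda>n. length (lF n))"
      by (rule monoI) (use prefix in force)
    show "(\<exists>F_lim Q_lim. real_distribution F_lim \<and> real_distribution Q_lim \<and>
         weak_conv_m (fit_belief M j \<omega>) F_lim \<and> weak_conv_m (quality_belief M j \<omega>) Q_lim) \<and>
      ((learned M j \<omega> \<and> weak_conv_m (fit_belief M j \<omega>) (return borel ?x) \<and>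
        weak_conv_m (quality_belief M j \<omega>) (return borel ?q)) \<or> lost M j \<omega>)"
    proof (cases "filterlim (\<lambda>n. length (lF n)) at_top sequentially")
      case True
      note freq = freqF[OF True]
      have "filterlim (\<lambda>n. real (length (lF n))) at_top sequentially"
        by (rule filterlim_compose[OF filterlim_real_sequentially True])
      \<comment> \<open>The number of qualities is the number of successful fits: a frequency with
        limit \<open>?x > 0\<close> times a length that diverges.\<close>
      then have "filterlim (\<lambda>n. count_list (lF n) True / length (lF n) * real (length (lF n))) at_top sequentially"
        using fit_prob_bounds[OF j] by (intro filterlim_tendsto_pos_mult_at_top[OF freq]) auto
      moreover have "count_list (lF n) True / length (lF n) * real (length (lF n)) = real (length (lQ n))" for n
        by (cases "lF n = []") (auto simp: lenQ)
      ultimately have lenQ_top: "filterlim (\<lambda>n. length (lQ n)) at_top sequentially"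
        by (simp add: filterlim_sequentially_iff_filterlim_real)
      have freqQ': "(\<lambda>n. count_list (lQ n) True / length (lQ n)) \<longlonglongrightarrow> ?q"
      proof (cases "?q \<in> {0<..<1}")
        case True then show ?thesis by (rule freqQ[OF _ lenQ_top])
      next
        case False
        \<comment> \<open>Almost surely the observed history has positive probability, which at an
          extreme quality leaves only one possible observation; the frequency is then exact.\<close>
        then consider "?q = 0" | "?q = 1" using quality_bounds[OF j] by fastforce
        then show ?thesis
        proof cases
          case 1
          then have "count_list (lQ n) True = 0" for n
            using posQ[of n] by (auto simp: bern_lik_eq power_0_left split: if_splits)
          then show ?thesis by (simp add: 1)
        next
          case 2
          then have "count_list (lQ n) False = 0" for n
            using posQ[of n] by (auto simp: bern_lik_eq power_0_left split: if_splits)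
          then have *: "count_list (lQ n) True = length (lQ n)" for n
            using count_list_True_False[of "lQ n"] by simp
          have "eventually (\<lambda>n. 1 \<le> length (lQ n)) sequentially"
            using lenQ_top unfolding filterlim_at_top by blast
          then show ?thesis
            unfolding 2 by (intro tendsto_eventually) (auto elim!: eventually_mono simp: *)
        qed
      qed
      have "concentrates_at (fit_belief M j \<omega>) ?x"
        unfolding fitB using fit_prob_bounds[OF j]
        by (intro concentrates_at_bayes fit_prior[OF j] posF True freq) auto
      moreover have "concentrates_at (quality_belief M j \<omega>) ?q"
        unfolding qualityB
        by (intro concentrates_at_bayes quality_prior[OF j] quality_bounds[OF j] posQ lenQ_top freqQ')
      moreover have "real_distribution (return borel a)" for a :: real
        by (intro real_distribution.intro prob_space_return) (auto simp: real_distribution_axioms_def)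
      moreover have "weak_conv_m (fit_belief M j \<omega>) (return borel ?x)"
        using calculation(1) rdF by (intro concentrates_at_imp_weak_conv) (simp_all add: fitB)
      moreover have "weak_conv_m (quality_belief M j \<omega>) (return borel ?q)"
        using calculation(2) rdQ by (intro concentrates_at_imp_weak_conv) (simp_all add: qualityB)
      ultimately show ?thesis unfolding learned_def by blast
    next
      case False
      then obtain K where K: "\<not> eventually (\<lambda>n. K \<le> length (lF n)) sequentially"
        by (auto simp: filterlim_at_top)
      \<comment> \<open>The lengths are monotone, so one round with length at least \<open>K\<close>
        would make all later ones so.\<close>
      have "length (lF n) < K" for n
        using K monoD[OF mono, of n] by (force simp: eventually_sequentially not_le)
      then have "finite (range (\<lambda>n. length (lF n)))"
        by (auto intro: finite_subset[of _ "{..<K}"])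
      then obtain n0 where n0: "length (lF n0) = Max (range (\<lambda>n. length (lF n)))"
        using Max_in[of "range (\<lambda>n. length (lF n))"] by fastforce
      \<comment> \<open>The lists extend one another, so a prefix of maximal length equals its
        extension. The qualities then freeze too, since \<open>lenQ\<close> ties their number to the
        fits.\<close>
      have F: "lF n = lF n0" if "n0 \<le> n" for n
      proof -
        have "length (lF n) \<le> length (lF n0)"
          unfolding n0 using \<open>finite _\<close> by (intro Max_ge) auto
        then show ?thesis using prefix(1)[OF that] by auto
      qed
      have Q: "lQ n = lQ n0" if "n0 \<le> n" for n
        using prefix(2)[OF that] F[OF that] lenQ[of n] lenQ[of n0] by auto
      have ev: "eventually (\<lambda>n. fit_belief M j \<omega> n = bayes (fit_prior M j) (lF n0)) sequentially"
        "eventually (\<lambda>n. quality_belief M j \<omega> n = bayes (quality_prior M j) (lQ n0)) sequentially"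
        using F Q unfolding eventually_sequentially fitB qualityB by metis+
      have "weak_conv_m (fit_belief M j \<omega>) (bayes (fit_prior M j) (lF n0))"
        "weak_conv_m (quality_belief M j \<omega>) (bayes (quality_prior M j) (lQ n0))"
        by (rule eventually_const_imp_weak_conv ev)+
      moreover have "lost M j \<omega>"
      proof -
        \<comment> \<open>Both lists are constant from \<open>n0\<close> on, which almost surely
          excludes a positive index.\<close>
        have "?I (lF n0) (lQ n0) \<le> 0"
          using not_stuck[of "lF n0" "lQ n0" n0] F Q not_less by blast
        then have "?I (lF n) (lQ n) \<le> 0" if "n0 \<le> n" for n
          using F[OF that] Q[OF that] by simp
        then show ?thesis unfolding lost_def fitB qualityB by blast
      qed
      ultimately show ?thesis using rdF rdQ by blast
    qed
  qed
qed

end
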